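(* Let $\Omega\subset\mathbf{R}^d$ be an open set with boundary $\Gamma$. For all $i,j\in\{1,\ldots,d\}$ let $a_{ij}\in L_\infty(\Omega,\mathbf{C})$, let $\theta\in[0,\frac\pi2)$ and suppose $\sum_{i,j=1}^d a_{ij}(x)\,\xi_i\,\overline{\xi_j}\in\Sigma_\theta$ for all $\xi\in\mathbf{C}^d$ and a.e. $x\in\Omega$. Let $\mu$ be a positive Borel measure on $\Gamma$ such that $\mu(K)<\infty$ for every compact $K\subset\Gamma$. Define the form $a$ by $D(a)=\{u\in H^1(\Omega)\cap C(\overline\Omega):\int_\Gamma|u|^2\,d\mu<\infty\}$ and $$a(u,v)=\sum_{i,j=1}^d\int_\Omega(\partial_iu)\,a_{ij}\,\overline{\partial_jv}+\int_\Gamma u\,\overline v\,d\mu,$$ and let $A$ be the operator in $L_2(\Omega)$ associated with $a$. Suppose that the Neumann form $a_N$, given by $D(a_N)=H^1(\Omega)$ and $a_N(u,v)=\sum_{i,j=1}^d\int_\Omega(\partial_iu)\,a_{ij}\,\overline{\partial_jv}$, is closable. Let $u,f\in L_2(\Omega)$. Then $u\in D(A)$ and $Au=f$ if and only if $u\in H^1_{a,\mu}(\Omega)$, $\mathcal{A}u=f$ weakly on $\Omega$ and there exists a $\varphi\in L_2(\Gamma,\mu)$ such that $\varphi$ is a trace of $u$ and $$\overline{a_N}(u,v)-\int_\Omega(\mathcal{A}u)\,\overline v=-\int_\Gamma\varphi\,\overline v\,d\mu$$ for all $v\in D(a)$. If these conditions are valid, then the function $\varphi$ is unique.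
   Context: $\Sigma_\theta=\{re^{i\alpha}:r\ge0,\ |\alpha|\le\theta\}$. The form $a$ is densely defined and sectorial in $L_2(\Omega)$ with vertex $0$, possibly not closable. The operator $A$ associated with $a$ is the well-defined $m$-sectorial operator in $L_2(\Omega)$ such that $x\in D(A)$ and $Ax=f$ if and only if there exist $u_1,u_2,\ldots\in D(a)$ with $(\operatorname{Re}a(u_n,u_n))_n$ bounded, $u_n\to x$ in $L_2(\Omega)$ and $a(u_n,v)\to(f,v)_{L_2(\Omega)}$ for all $v\in D(a)$. The closure $\overline{a_N}$ has domain $D(\overline{a_N})\subset L_2(\Omega)$, with norm $(\operatorname{Re}\overline{a_N}(u,u)+\|u\|_2^2)^{1/2}$. For $u\in D(\overline{a_N})$ and $f\in L_2(\Omega)$, "$\mathcal{A}u=f$ weakly on $\Omega$" means $\overline{a_N}(u,v)=\int_\Omega f\,\overline v$ for all $v\in C_c^\infty(\Omega)$; such $f$ is unique and denoted $\mathcal{A}u$. For $u\in D(\overline{a_N})$ and $\varphi\in L_2(\Gamma,\mu)$, $\varphi$ is a trace (or $(a,\mu)$-trace) of $u$ if there exist $u_1,u_2,\ldots\in D(a)$ with $u_n\to u$ in $D(\overline{a_N})$ and $u_n|_\Gamma\to\varphi$ in $L_2(\Gamma,\mu)$ (traces need not be unique). $H^1_{a,\mu}(\Omega)$ is the set of all $u\in D(\overline{a_N})$ that have a trace in $L_2(\Gamma,\mu)$. *)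

theory Defs
  imports "HOL-Analysis.Analysis"
begin

text \<open>
  Elements of an \<open>L\<^sub>2\<close> space are represented by square-integrable functions; equality in
  \<open>L\<^sub>2\<close> is equality almost everywhere and convergence is convergence in the seminorm \<open>L2_norm\<close>.
\<close>

definition L2 :: "'x measure \<Rightarrow> ('x \<Rightarrow> complex) set" where
  "L2 M = {u. u \<in> borel_measurable M \<and> integrable M (\<lambda>x. (cmod (u x))\<^sup>2)}"

definition L2_norm :: "'x measure \<Rightarrow> ('x \<Rightarrow> complex) \<Rightarrow> real" where
  "L2_norm M u = sqrt (\<integral>x. (cmod (u x))\<^sup>2 \<partial>M)"

definition L2_inner :: "'x measure \<Rightarrow> ('x \<Rightarrow> complex) \<Rightarrow> ('x \<Rightarrow> complex) \<Rightarrow> complex" where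
  "L2_inner M u v = (\<integral>x. u x * cnj (v x) \<partial>M)"

definition L2_tendsto :: "'x measure \<Rightarrow> (nat \<Rightarrow> 'x \<Rightarrow> complex) \<Rightarrow> ('x \<Rightarrow> complex) \<Rightarrow> bool" where
  "L2_tendsto M s u \<longleftrightarrow> (\<lambda>n. L2_norm M (\<lambda>x. s n x - u x)) \<longlonglongrightarrow> 0"

definition Linf :: "'x measure \<Rightarrow> ('x \<Rightarrow> complex) set" where
  "Linf M = {u. u \<in> borel_measurable M \<and> (\<exists>C. AE x in M. cmod (u x) \<le> C)}"

definition sector :: "real \<Rightarrow> complex set" where
  "sector \<theta> = {complex_of_real r * cis \<alpha> | r \<alpha>. 0 \<le> r \<and> \<bar>\<alpha>\<bar> \<le> \<theta>}"


subsection \<open>Sobolev spaces\<close>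

definition pdiff :: "'n \<Rightarrow> (real ^ 'n \<Rightarrow> complex) \<Rightarrow> real ^ 'n::finite \<Rightarrow> complex" where
  "pdiff i f x = frechet_derivative f (at x) (axis i 1)"

primrec Ck :: "nat \<Rightarrow> (real ^ 'n::finite \<Rightarrow> complex) \<Rightarrow> bool" where
  "Ck 0 f = continuous_on UNIV f"
| "Ck (Suc k) f = ((\<forall>x. f differentiable (at x)) \<and> (\<forall>i. Ck k (pdiff i f)))"

text \<open>\<open>C\<^sub>c\<^sup>\<infinity>(\<Omega>)\<close>, its elements being extended by zero to the whole space.\<close>

definition test_functions :: "(real ^ 'n::finite) set \<Rightarrow> (real ^ 'n \<Rightarrow> complex) set" where
  "test_functions \<Omega> =
     {v. (\<forall>k. Ck k v) \<and> (\<exists>K. compact K \<and> K \<subseteq> \<Omega> \<and> (\<forall>x. x \<notin> K \<longrightarrow> v x = 0))}"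

definition is_weak_partial ::
    "(real ^ 'n::finite) set \<Rightarrow> 'n \<Rightarrow> (real ^ 'n \<Rightarrow> complex) \<Rightarrow> (real ^ 'n \<Rightarrow> complex) \<Rightarrow> bool" where
  "is_weak_partial \<Omega> i u g \<longleftrightarrow>
     (\<forall>v \<in> test_functions \<Omega>.
        (\<integral>x. u x * pdiff i v x \<partial>lebesgue_on \<Omega>) = - (\<integral>x. g x * v x \<partial>lebesgue_on \<Omega>))"

definition H1 :: "(real ^ 'n::finite) set \<Rightarrow> (real ^ 'n \<Rightarrow> complex) set" where
  "H1 \<Omega> = {u \<in> L2 (lebesgue_on \<Omega>). \<forall>i. \<exists>g \<in> L2 (lebesgue_on \<Omega>). is_weak_partial \<Omega> i u g}"

text \<open>The weak partial derivative of an element of \<open>H1\<close>; it is determined almost everywhere.\<close>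

definition weak_partial ::
    "(real ^ 'n::finite) set \<Rightarrow> 'n \<Rightarrow> (real ^ 'n \<Rightarrow> complex) \<Rightarrow> real ^ 'n \<Rightarrow> complex" where
  "weak_partial \<Omega> i u = (SOME g. g \<in> L2 (lebesgue_on \<Omega>) \<and> is_weak_partial \<Omega> i u g)"


subsection \<open>Sectorial forms with vertex 0 in \<open>L\<^sub>2(M)\<close>\<close>

type_synonym 'x form = "('x \<Rightarrow> complex) \<Rightarrow> ('x \<Rightarrow> complex) \<Rightarrow> complex"

definition form_norm :: "'x measure \<Rightarrow> 'x form \<Rightarrow> ('x \<Rightarrow> complex) \<Rightarrow> real" where
  "form_norm M a u = sqrt (Re (a u u) + (L2_norm M u)\<^sup>2)"

definition form_tendsto ::
    "'x measure \<Rightarrow> 'x form \<Rightarrow> (nat \<Rightarrow> 'x \<Rightarrow> complex) \<Rightarrow> ('x \<Rightarrow> complex) \<Rightarrow> bool" where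
  "form_tendsto M a s u \<longleftrightarrow> (\<lambda>n. form_norm M a (\<lambda>x. s n x - u x)) \<longlonglongrightarrow> 0"

definition form_Cauchy :: "'x measure \<Rightarrow> 'x form \<Rightarrow> (nat \<Rightarrow> 'x \<Rightarrow> complex) \<Rightarrow> bool" where
  "form_Cauchy M a s \<longleftrightarrow>
     (\<forall>e>0. \<exists>N. \<forall>m\<ge>N. \<forall>n\<ge>N. form_norm M a (\<lambda>x. s m x - s n x) < e)"

definition form_closable :: "'x measure \<Rightarrow> ('x \<Rightarrow> complex) set \<Rightarrow> 'x form \<Rightarrow> bool" where
  "form_closable M D a \<longleftrightarrow>
     (\<forall>s. (\<forall>n. s n \<in> D) \<and> form_Cauchy M a s \<and> L2_tendsto M s (\<lambda>_. 0)
        \<longrightarrow> (\<lambda>n. a (s n) (s n)) \<longlonglongrightarrow> 0)"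

definition form_approx ::
    "'x measure \<Rightarrow> ('x \<Rightarrow> complex) set \<Rightarrow> 'x form \<Rightarrow> (nat \<Rightarrow> 'x \<Rightarrow> complex) \<Rightarrow> ('x \<Rightarrow> complex) \<Rightarrow> bool" where
  "form_approx M D a s u \<longleftrightarrow> (\<forall>n. s n \<in> D) \<and> form_Cauchy M a s \<and> L2_tendsto M s u"

definition closure_dom ::
    "'x measure \<Rightarrow> ('x \<Rightarrow> complex) set \<Rightarrow> 'x form \<Rightarrow> ('x \<Rightarrow> complex) set" where
  "closure_dom M D a = {u \<in> L2 M. \<exists>s. form_approx M D a s u}"

text \<open>
  The closure of a closable form: the limit of \<open>a (s n) (t n)\<close> exists and does not depend on
  the approximating sequences.  Only meaningful for arguments in \<open>closure_dom M D a\<close>.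
\<close>

definition closure_form :: "'x measure \<Rightarrow> ('x \<Rightarrow> complex) set \<Rightarrow> 'x form \<Rightarrow> 'x form" where
  "closure_form M D a u v =
     (THE c. \<exists>s t. form_approx M D a s u \<and> form_approx M D a t v \<and> (\<lambda>n. a (s n) (t n)) \<longlonglongrightarrow> c)"

text \<open>
  The (graph of the) operator associated with a form that need not be closable:
  \<open>(x, f) \<in> assoc_op M D a\<close> means \<open>x \<in> D(A)\<close> and \<open>A x = f\<close>.
\<close>

definition assoc_op ::
    "'x measure \<Rightarrow> ('x \<Rightarrow> complex) set \<Rightarrow> 'x form \<Rightarrow> (('x \<Rightarrow> complex) \<times> ('x \<Rightarrow> complex)) set" where
  "assoc_op M D a =
     {(x, f). x \<in> L2 M \<and> f \<in> L2 M \<and>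
        (\<exists>s. (\<forall>n. s n \<in> D) \<and> bounded (range (\<lambda>n. Re (a (s n) (s n)))) \<and> L2_tendsto M s x \<and>
             (\<forall>v \<in> D. (\<lambda>n. a (s n) v) \<longlonglongrightarrow> L2_inner M f v))}"


subsection \<open>The Neumann form and the form with boundary measure\<close>

definition neumann_form ::
    "(real ^ 'n::finite) set \<Rightarrow> ('n \<Rightarrow> 'n \<Rightarrow> real ^ 'n \<Rightarrow> complex) \<Rightarrow> (real ^ 'n) form" where
  "neumann_form \<Omega> c u v =
     (\<Sum>i\<in>UNIV. \<Sum>j\<in>UNIV.
        \<integral>x. weak_partial \<Omega> i u x * c i j x * cnj (weak_partial \<Omega> j v x) \<partial>lebesgue_on \<Omega>)"

text \<open>
  Elements of \<open>H\<^sup>1(\<Omega>) \<inter> C(closure \<Omega>)\<close> are represented by their continuous representative on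
  \<open>closure \<Omega>\<close>, so that restriction to the boundary is restriction of functions.
\<close>

definition bdry_dom ::
    "(real ^ 'n::finite) set \<Rightarrow> (real ^ 'n) measure \<Rightarrow> (real ^ 'n \<Rightarrow> complex) set" where
  "bdry_dom \<Omega> \<mu> = {u \<in> H1 \<Omega>. continuous_on (closure \<Omega>) u \<and> (\<integral>\<^sup>+x. ennreal ((cmod (u x))\<^sup>2) \<partial>\<mu>) < \<infinity>}"

definition bdry_form ::
    "(real ^ 'n::finite) set \<Rightarrow> (real ^ 'n) measure \<Rightarrow> ('n \<Rightarrow> 'n \<Rightarrow> real ^ 'n \<Rightarrow> complex)
       \<Rightarrow> (real ^ 'n) form" where
  "bdry_form \<Omega> \<mu> c u v = neumann_form \<Omega> c u v + (\<integral>x. u x * cnj (v x) \<partial>\<mu>)"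

definition neumann_closure_dom ::
    "(real ^ 'n::finite) set \<Rightarrow> ('n \<Rightarrow> 'n \<Rightarrow> real ^ 'n \<Rightarrow> complex) \<Rightarrow> (real ^ 'n \<Rightarrow> complex) set" where
  "neumann_closure_dom \<Omega> c = closure_dom (lebesgue_on \<Omega>) (H1 \<Omega>) (neumann_form \<Omega> c)"

definition neumann_closure ::
    "(real ^ 'n::finite) set \<Rightarrow> ('n \<Rightarrow> 'n \<Rightarrow> real ^ 'n \<Rightarrow> complex) \<Rightarrow> (real ^ 'n) form" where
  "neumann_closure \<Omega> c = closure_form (lebesgue_on \<Omega>) (H1 \<Omega>) (neumann_form \<Omega> c)"

text \<open>\<open>\<A> u = f\<close> weakly on \<open>\<Omega>\<close>, and the function \<open>\<A> u\<close> itself (determined almost everywhere).\<close>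

definition weakly_eq ::
    "(real ^ 'n::finite) set \<Rightarrow> ('n \<Rightarrow> 'n \<Rightarrow> real ^ 'n \<Rightarrow> complex)
       \<Rightarrow> (real ^ 'n \<Rightarrow> complex) \<Rightarrow> (real ^ 'n \<Rightarrow> complex) \<Rightarrow> bool" where
  "weakly_eq \<Omega> c u f \<longleftrightarrow>
     u \<in> neumann_closure_dom \<Omega> c \<and> f \<in> L2 (lebesgue_on \<Omega>) \<and>
     (\<forall>v \<in> test_functions \<Omega>. neumann_closure \<Omega> c u v = (\<integral>x. f x * cnj (v x) \<partial>lebesgue_on \<Omega>))"

definition weak_op ::
    "(real ^ 'n::finite) set \<Rightarrow> ('n \<Rightarrow> 'n \<Rightarrow> real ^ 'n \<Rightarrow> complex)
       \<Rightarrow> (real ^ 'n \<Rightarrow> complex) \<Rightarrow> real ^ 'n \<Rightarrow> complex" where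
  "weak_op \<Omega> c u = (SOME f. weakly_eq \<Omega> c u f)"

definition is_trace ::
    "(real ^ 'n::finite) set \<Rightarrow> (real ^ 'n) measure \<Rightarrow> ('n \<Rightarrow> 'n \<Rightarrow> real ^ 'n \<Rightarrow> complex)
       \<Rightarrow> (real ^ 'n \<Rightarrow> complex) \<Rightarrow> (real ^ 'n \<Rightarrow> complex) \<Rightarrow> bool" where
  "is_trace \<Omega> \<mu> c u \<phi> \<longleftrightarrow>
     u \<in> neumann_closure_dom \<Omega> c \<and> \<phi> \<in> L2 \<mu> \<and>
     (\<exists>s. (\<forall>n. s n \<in> bdry_dom \<Omega> \<mu>) \<and>
          form_tendsto (lebesgue_on \<Omega>) (neumann_closure \<Omega> c) s u \<and>
          L2_tendsto \<mu> s \<phi>)"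

definition H1_trace ::
    "(real ^ 'n::finite) set \<Rightarrow> (real ^ 'n) measure \<Rightarrow> ('n \<Rightarrow> 'n \<Rightarrow> real ^ 'n \<Rightarrow> complex)
       \<Rightarrow> (real ^ 'n \<Rightarrow> complex) set" where
  "H1_trace \<Omega> \<mu> c = {u \<in> neumann_closure_dom \<Omega> c. \<exists>\<phi> \<in> L2 \<mu>. is_trace \<Omega> \<mu> c u \<phi>}"

definition weak_conormal ::
    "(real ^ 'n::finite) set \<Rightarrow> (real ^ 'n) measure \<Rightarrow> ('n \<Rightarrow> 'n \<Rightarrow> real ^ 'n \<Rightarrow> complex)
       \<Rightarrow> (real ^ 'n \<Rightarrow> complex) \<Rightarrow> (real ^ 'n \<Rightarrow> complex) \<Rightarrow> bool" where
  "weak_conormal \<Omega> \<mu> c u \<phi> \<longleftrightarrow>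
     (\<forall>v \<in> bdry_dom \<Omega> \<mu>.
        neumann_closure \<Omega> c u v - (\<integral>x. weak_op \<Omega> c u x * cnj (v x) \<partial>lebesgue_on \<Omega>)
          = - (\<integral>x. \<phi> x * cnj (v x) \<partial>\<mu>))"

end

theory Submission
  imports Defs "HOL-Computational_Algebra.Polynomial"
begin

text \<open>
  The form \<open>a\<close> splits as the Neumann form on \<open>\<Omega>\<close> plus the \<open>L\<^sub>2(\<mu>)\<close> inner product on the boundary.  Given a
  sequence in \<open>D(a)\<close> that is bounded in the form norm and witnesses \<open>A u = f\<close>, averaging its tails
  (and the parallelogram law) produces a sequence with the same limits that is Cauchy in the form
  norm.  It is then Cauchy for the Neumann form and, on the boundary, in \<open>L\<^sub>2(\<mu>)\<close>; the limit in
  \<open>L\<^sub>2(\<mu>)\<close> is the trace \<open>\<phi>\<close>, and passing to the limit in \<open>a(u\<^sub>n, v)\<close> gives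
  \<open>a\<^sub>N(u, v) + (\<phi>, v) = (f, v)\<close> for the closure of \<open>a\<^sub>N\<close> and all \<open>v \<in> D(a)\<close>.  This identity encodes both
  the weak equation (test functions vanish on the boundary) and the conormal condition.  Conversely a
  sequence defining the trace witnesses \<open>A u = f\<close>.  Two traces \<open>\<phi>\<close>, \<open>\<psi>\<close> that both satisfy the
  conormal condition have a difference orthogonal to \<open>D(a)\<close> in \<open>L\<^sub>2(\<mu>)\<close>; as \<open>\<phi>\<close> and \<open>\<psi>\<close> are themselves
  limits of elements of \<open>D(a)\<close>, the difference vanishes.
\<close>

section \<open>Smooth functions\<close>

text \<open>The obstacle is that \<open>a\<close> may fail to be closable, so no closure of
  \<open>a\<close> is at hand, and the definition of \<open>A\<close> supplies bounded sequences
  while a trace demands norm convergence. Averaging helps because the requirements on the sequence,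
  convergence in L2 and of each \<open>a(u_n, v)\<close>, survive convex combinations of tails.
  Closability of \<open>a_N\<close> makes the interior part of the limit depend on \<open>u\<close>
  alone; nothing similar holds on the boundary, so uniqueness of \<phi> has to come from the
  conormal condition. Much of the analysis serves well-definedness: weak derivatives and
  \<open>weak_op\<close> are choices, so linearity of the form and the meaning of the conormal
  condition rest on the fact that test functions determine an L2 function almost everywhere, which
  calls for smooth bumps. That test functions lie in \<open>D(a)\<close> in turn needs integration
  by parts. The sector condition comes for each vector with its own null set; it becomes a numerical
  bound with constant \<open>tan \<theta>\<close> off one common null set.\<close>

lemma pdiff_eqI: "(f has_derivative f') (at x) \<Longrightarrow> pdiff i f x = f' (axis i 1)"
  unfolding pdiff_def by (drule frechet_derivative_at) simp

lemma Ck_imp_continuous: "Ck k f \<Longrightarrow> continuous_on UNIV f"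
  by (cases k) (auto intro!: differentiable_imp_continuous_within continuous_at_imp_continuous_on)

lemma Ck_SucD: "Ck (Suc k) f \<Longrightarrow> Ck k f"
proof (induction k arbitrary: f)
  case 0
  then show ?case using Ck_imp_continuous[OF 0] by simp
qed simp

lemma pdiff_add:
  assumes "f differentiable (at x)" "g differentiable (at x)"
  shows "pdiff i (\<lambda>x. f x + g x) x = pdiff i f x + pdiff i g x"
  using pdiff_eqI[OF has_derivative_add[OF assms[unfolded frechet_derivative_works]]]
  by (simp add: pdiff_def)

lemma pdiff_mult:
  assumes "f differentiable (at x)" "g differentiable (at x)"
  shows "pdiff i (\<lambda>x. f x * g x) x = f x * pdiff i g x + pdiff i f x * g x"
  using pdiff_eqI[OF has_derivative_mult[OF assms[unfolded frechet_derivative_works]]]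
  by (simp add: pdiff_def)

lemma Ck_add: "Ck k f \<Longrightarrow> Ck k g \<Longrightarrow> Ck k (\<lambda>x. f x + g x)"
proof (induction k arbitrary: f g)
  case (Suc k)
  then have "pdiff i (\<lambda>x. f x + g x) = (\<lambda>x. pdiff i f x + pdiff i g x)" for i
    by (auto simp: pdiff_add)
  with Suc show ?case by auto
qed (auto intro: continuous_intros)

lemma Ck_mult: "Ck k f \<Longrightarrow> Ck k g \<Longrightarrow> Ck k (\<lambda>x. f x * g x)"
proof (induction k arbitrary: f g)
  case (Suc k)
  then have "pdiff i (\<lambda>x. f x * g x) = (\<lambda>x. f x * pdiff i g x + pdiff i f x * g x)" for i
    by (auto simp: pdiff_mult)
  \<comment> \<open>The product rule leaves one factor undifferentiated, so both functions are
    needed at the lower order as well.\<close>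
  moreover have "Ck k f" "Ck k g" using Suc.prems[THEN Ck_SucD] by auto
  ultimately show ?case using Suc by (auto intro!: Ck_add)
qed (auto intro: continuous_intros)

lemma Ck_const: "Ck k (\<lambda>_ :: real ^ 'n::finite. z)"
proof (induction k arbitrary: z)
  case (Suc k)
  have "pdiff i (\<lambda>_ :: real ^ 'n. z) = (\<lambda>_. 0)" for i by (auto intro!: pdiff_eqI[THEN trans] derivative_intros)
  with Suc show ?case by auto
qed auto

lemma Ck_prod: "finite I \<Longrightarrow> (\<And>i. i \<in> I \<Longrightarrow> Ck k (f i)) \<Longrightarrow> Ck k (\<lambda>x. \<Prod>i\<in>I. f i x)"
  by (induction I rule: finite_induct) (auto intro: Ck_const Ck_mult)

text \<open>This class of functions contains \<open>exp (- 1 / t)\<close> and is closed under differentiation.\<close>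

definition expinv :: "real poly \<Rightarrow> real \<Rightarrow> real" where
  "expinv p t = (if 0 < t then poly p (1 / t) * exp (- (1 / t)) else 0)"

lemma poly_mult_exp_tendsto_0: "((\<lambda>x::real. poly p x * exp (- x)) \<longlongrightarrow> 0) at_top"
proof -
  have "((\<lambda>x. \<Sum>i\<le>degree p. coeff p i * (x ^ i / exp x)) \<longlongrightarrow> (\<Sum>i\<le>degree p. coeff p i * 0)) at_top"
    by (intro tendsto_intros tendsto_power_div_exp_0)
  then show ?thesis
    by (simp add: poly_altdef sum_distrib_right sum_divide_distrib exp_minus field_simps)
qed

text \<open>The exponential beats every power of \<open>1 / t\<close>. Dividing by \<open>t\<close>
  stays inside the class, so the same limit also serves the difference quotients at 0.\<close>

lemma expinv_tendsto_0: "(expinv p \<longlongrightarrow> 0) (at 0)"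
proof (rule filterlim_split_at_real)
  have "eventually (\<lambda>t. 0 = expinv p t) (at_left 0)"
    by (auto simp: expinv_def eventually_at_filter)
  then show "(expinv p \<longlongrightarrow> 0) (at_left 0)"
    by (rule Lim_transform_eventually[OF tendsto_const])
  have "((\<lambda>t. poly p (inverse t) * exp (- inverse t)) \<longlongrightarrow> 0) (at_right 0)"
    by (rule filterlim_compose[OF poly_mult_exp_tendsto_0 filterlim_inverse_at_top_right])
  moreover have "eventually (\<lambda>t. poly p (inverse t) * exp (- inverse t) = expinv p t) (at_right 0)"
    by (auto simp: expinv_def eventually_at_filter field_simps)
  ultimately show "(expinv p \<longlongrightarrow> 0) (at_right 0)"
    by (rule Lim_transform_eventually)
qed

text \<open>Writing X for \<open>1 / t\<close>, the derivative of X is \<open>- X^2\<close> and that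
  of \<open>exp (- X)\<close> is \<open>X^2 * exp (- X)\<close>; the factor
  \<open>[:0, 0, 1:]\<close> is X squared.\<close>

lemma expinv_has_derivative:
  "(expinv p has_real_derivative expinv ([:0, 0, 1:] * (p - pderiv p)) t) (at t)"
proof -
  consider "t < 0" | "t = 0" | "t > 0" by linarith
  then show ?thesis
  proof cases
    case 1
    have "((\<lambda>_. 0) has_real_derivative 0) (at t)" by simp
    then have "(expinv p has_real_derivative 0) (at t)"
      by (rule has_field_derivative_transform_within_open[where S="{..<0}"]) (use 1 in \<open>auto simp: expinv_def\<close>)
    then show ?thesis using 1 by (simp add: expinv_def)
  next
    case 2
    \<comment> \<open>\<open>pCons 0 p\<close> is the polynomial X times \<open>p\<close>; its extra
      factor \<open>1 / h\<close> is the division in the difference quotient.\<close>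
    have "((\<lambda>h. expinv (pCons 0 p) h) \<longlongrightarrow> 0) (at 0)" by (rule expinv_tendsto_0)
    moreover have "expinv (pCons 0 p) = (\<lambda>h. (expinv p (0 + h) - expinv p 0) / h)"
      by (auto simp: expinv_def)
    ultimately show ?thesis using 2 by (simp add: DERIV_def) (simp add: expinv_def)
  next
    case 3
    have "((\<lambda>s. poly p (1/s) * exp (- (1/s))) has_real_derivative
       expinv ([:0, 0, 1:] * (p - pderiv p)) t) (at t)"
      using 3 unfolding expinv_def
      by (auto intro!: derivative_eq_intros DERIV_chain'[OF _ poly_DERIV]
          simp: field_simps power2_eq_square)
    then show ?thesis
      by (rule has_field_derivative_transform_within_open[where S="{0<..}"]) (use 3 in \<open>auto simp: expinv_def\<close>)
  qed
qed

text \<open>The free constant \<open>z\<close> absorbs the inner derivative, \<alpha> in direction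
  \<open>i\<close> and 0 in the others, so the family is closed under \<open>pdiff\<close> and the
  induction runs over all \<open>p\<close> at once.\<close>

lemma Ck_expinv: "Ck k (\<lambda>x. z * complex_of_real (expinv p (\<alpha> * x $ i + \<beta>)))"
proof (induction k arbitrary: z p)
  case 0
  have "continuous_on UNIV (expinv p)"
    by (meson DERIV_isCont continuous_at_imp_continuous_on expinv_has_derivative)
  then show ?case
    by (auto intro!: continuous_intros continuous_on_compose2[of UNIV "expinv p"])
next
  case (Suc k)
  let ?q = "[:0, 0, 1:] * (p - pderiv p)"
  have D: "((\<lambda>x. z * complex_of_real (expinv p (\<alpha> * x $ i + \<beta>))) has_derivative
      (\<lambda>h. z * complex_of_real (expinv ?q (\<alpha> * x $ i + \<beta>) * (\<alpha> * h $ i)))) (at x)" for x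
  proof -
    have "((\<lambda>x. \<alpha> * x $ i + \<beta>) has_derivative (\<lambda>h. \<alpha> * h $ i)) (at x)"
      by (auto intro!: derivative_eq_intros bounded_linear_vec_nth bounded_linear_imp_has_derivative)
    from has_derivative_compose[OF this expinv_has_derivative[unfolded has_field_derivative_def]]
    show ?thesis
      by (auto intro!: derivative_eq_intros simp: o_def)
  qed
  have "pdiff j (\<lambda>x. z * complex_of_real (expinv p (\<alpha> * x $ i + \<beta>))) =
    (\<lambda>x. (if j = i then z * complex_of_real \<alpha> else 0) * complex_of_real (expinv ?q (\<alpha> * x $ i + \<beta>)))" for j
    by (rule ext, subst pdiff_eqI[OF D]) (auto simp: axis_def)
  with Suc D show ?case by (auto simp: differentiable_def)
qed

text \<open>For positive \<open>m\<close> each pair of factors vanishes unless \<open>x $ i\<close>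
  lies strictly between \<open>a $ i\<close> and \<open>b $ i\<close>. As \<open>m\<close> grows,
  \<open>exp (- 1 / (m * t))\<close> rises to 1, so the bumps approximate the indicator of the open
  box from below.\<close>

definition box_bump :: "real \<Rightarrow> real ^ 'n::finite \<Rightarrow> real ^ 'n \<Rightarrow> real ^ 'n \<Rightarrow> complex" where
  "box_bump m a b x =
     (\<Prod>i\<in>UNIV. complex_of_real (expinv 1 (m * (x $ i - a $ i))) * complex_of_real (expinv 1 (m * (b $ i - x $ i))))"

lemma box_bump_Ck: "Ck k (box_bump m a b)"
proof -
  have "Ck k (\<lambda>x. complex_of_real (expinv 1 (m * (x $ i - a $ i))))" for i
    using Ck_expinv[of k 1 1 m i "- (m * a $ i)"] by (simp add: algebra_simps)
  moreover have "Ck k (\<lambda>x. complex_of_real (expinv 1 (m * (b $ i - x $ i))))" for i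
    using Ck_expinv[of k 1 1 "-m" i "m * b $ i"] by (simp add: algebra_simps)
  ultimately show ?thesis
    unfolding box_bump_def[abs_def] by (intro Ck_prod Ck_mult) auto
qed

lemma box_bump_eq_0: "0 < m \<Longrightarrow> x \<notin> box a b \<Longrightarrow> box_bump m a b x = 0"
  by (auto simp: box_bump_def expinv_def mem_box_cart zero_less_mult_iff)

lemma norm_box_bump_le: "norm (box_bump m a b x) \<le> 1"
proof -
  have *: "\<bar>expinv 1 t\<bar> \<le> 1" for t by (auto simp: expinv_def)
  show ?thesis unfolding box_bump_def
    by (subst prod_norm[symmetric]) (auto intro!: prod_le_1 mult_le_one * simp: norm_mult)
qed

lemma box_bump_test_function:
  assumes "0 < m" "cbox a b \<subseteq> \<Omega>"
  shows "box_bump m a b \<in> test_functions \<Omega>"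
proof -
  have "box_bump m a b x = 0" if "x \<notin> cbox a b" for x
    using that box_subset_cbox[of a b] by (intro box_bump_eq_0[OF assms(1)]) auto
  then show ?thesis
    using assms(2) box_bump_Ck by (auto simp: test_functions_def intro!: exI[of _ "cbox a b"])
qed

lemma box_bump_tendsto:
  "(\<lambda>n. box_bump (real (Suc n)) a b x) \<longlonglongrightarrow> indicator (box a b) x"
proof (cases "x \<in> box a b")
  case True
  have *: "(\<lambda>n. complex_of_real (expinv 1 (real (Suc n) * t))) \<longlonglongrightarrow> 1" if "t > 0" for t
  proof -
    have "(\<lambda>n. complex_of_real (exp (- (inverse (real (Suc n)) * (1 / t))))) \<longlonglongrightarrow> complex_of_real (exp (- (0 * (1 / t))))"
      by (intro tendsto_intros LIMSEQ_inverse_real_of_nat)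
    then show ?thesis using that by (simp add: expinv_def field_simps del: of_nat_Suc)
  qed
  have "(\<lambda>n. box_bump (real (Suc n)) a b x) \<longlonglongrightarrow> (\<Prod>i\<in>(UNIV::'a set). 1 * 1)"
    unfolding box_bump_def using True
    by (intro tendsto_prod tendsto_mult *) (auto simp: mem_box_cart)
  then show ?thesis using True by simp
qed (simp add: box_bump_eq_0)

section \<open>The fundamental lemma of the calculus of variations\<close>

lemma sigma_finite_lebesgue: "sigma_finite_measure (lebesgue :: 'a::euclidean_space measure)"
proof
  obtain A :: "'a set set" where "countable A" "A \<subseteq> sets lborel" "\<Union>A = space lborel" "\<forall>a\<in>A. emeasure lborel a \<noteq> \<infinity>"
    using lborel.sigma_finite_countable by blast
  then show "\<exists>A. countable A \<and> A \<subseteq> sets (lebesgue :: 'a measure) \<and> \<Union>A = space lebesgue \<and> (\<forall>a\<in>A. emeasure lebesgue a \<noteq> \<infinity>)"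
    by (intro exI[of _ A]) auto
qed

text \<open>Open boxes form an intersection-stable generator of the Borel sets, and the Borel sets
  over which \<open>h\<close> integrates to 0 are closed under complements, by \<open>h0\<close>,
  and under countable disjoint unions.\<close>

lemma lebesgue_null_boxes:
  fixes h :: "'a::euclidean_space \<Rightarrow> complex"
  assumes h: "integrable lebesgue h"
    and box0: "\<And>a b. (\<integral>x. indicator (box a b) x *\<^sub>R h x \<partial>lebesgue) = 0"
    and h0: "(\<integral>x. h x \<partial>lebesgue) = 0"
  shows "AE x in lebesgue. h x = 0"
proof (rule sigma_finite_measure.density_zero[OF sigma_finite_lebesgue h])
  let ?E = "range (\<lambda>(a, b). box a b :: 'a set)"
  have int: "integrable lebesgue (\<lambda>x. indicator A x *\<^sub>R h x)" if "A \<in> sets lebesgue" for A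
    by (rule integrable_mult_indicator[OF that h])
  have borel0: "(\<integral>x. indicator A x *\<^sub>R h x \<partial>lebesgue) = 0" if "A \<in> sets borel" for A
  proof -
    have E: "Int_stable ?E" "?E \<subseteq> Pow UNIV" by (auto simp: Int_stable_def box_Int_box)
    have A: "A \<in> sigma_sets UNIV ?E" using that by (simp add: borel_eq_box)
    have leb: "B \<in> sets lebesgue" if "B \<in> sigma_sets UNIV ?E" for B
    proof -
      have "sigma_sets UNIV ?E = sets (borel :: 'a measure)" by (simp add: borel_eq_box)
      with that show ?thesis by auto
    qed
    from E A show ?thesis
    proof (induct rule: sigma_sets_induct_disjoint)
      case (basic A)
      then show ?case using box0 by auto
    next
      case empty
      then show ?case by simp
    next
      case (compl A)
      have "(\<integral>x. indicator (UNIV - A) x *\<^sub>R h x \<partial>lebesgue)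
          = (\<integral>x. h x - indicator A x *\<^sub>R h x \<partial>lebesgue)"
        by (rule Bochner_Integration.integral_cong) (auto simp: indicator_def)
      also have "\<dots> = 0"
        using int[OF leb[OF compl(1)]] h h0 compl by simp
      finally show ?case .
    next
      case (union A)
      have "A i \<in> sets lebesgue" for i using union leb by blast
      moreover have "set_integrable lebesgue (\<Union>i. A i) h"
        unfolding set_integrable_def using \<open>\<And>i. A i \<in> sets lebesgue\<close> by (intro int) auto
      ultimately have "(LINT x:(\<Union>i. A i)|lebesgue. h x) = (\<Sum>i. (LINT x:(A i)|lebesgue. h x))"
        using union(1) by (intro lebesgue_integral_countable_add) (auto simp: disjoint_family_on_def)
      then show ?case using union by (simp add: set_lebesgue_integral_def)
    qed
  qed
  fix A :: "'a set" assume A: "A \<in> sets lebesgue"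
  \<comment> \<open>A Lebesgue set differs from its Borel main part by a subset of a Borel null set,
    so the integral does not change.\<close>
  have "(\<integral>x. indicator A x *\<^sub>R h x \<partial>lebesgue)
      = (\<integral>x. indicator (main_part lborel A) x *\<^sub>R h x \<partial>lebesgue)"
  proof (rule integral_cong_AE)
    have "AE x in lebesgue. x \<notin> null_part lborel A"
    proof -
      obtain N where "N \<in> null_sets lborel" "null_part lborel A \<subseteq> N" using null_part[OF A] by blast
      then show ?thesis by (intro AE_completion AE_I'[of N]) auto
    qed
    moreover have "A = main_part lborel A \<union> null_part lborel A"
      using main_part_null_part_Un[OF A] by simp
    ultimately show "AE x in lebesgue. indicator A x *\<^sub>R h x = indicator (main_part lborel A) x *\<^sub>R h x"
      by (auto simp: indicator_def elim!: eventually_mono)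
    show "(\<lambda>x. indicator (main_part lborel A) x *\<^sub>R h x) \<in> borel_measurable lebesgue"
      using main_part_sets[OF A] by (intro borel_measurable_integrable int) auto
    show "(\<lambda>x. indicator A x *\<^sub>R h x) \<in> borel_measurable lebesgue"
      using A by (intro borel_measurable_integrable int) auto
  qed
  also have "\<dots> = 0" using main_part_sets[OF A] by (intro borel0) auto
  finally show "set_lebesgue_integral lebesgue A h = 0" by (simp add: set_lebesgue_integral_def)
qed

lemma test_function_continuous: "v \<in> test_functions \<Omega> \<Longrightarrow> continuous_on UNIV v"
  by (auto simp: test_functions_def dest: Ck_imp_continuous)

lemma compact_support_bounded:
  fixes v :: "'a::euclidean_space \<Rightarrow> complex"
  assumes "compact K" "continuous_on UNIV v" "\<And>x. x \<notin> K \<Longrightarrow> v x = 0"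
  obtains B where "0 \<le> B" "\<And>x. norm (v x) \<le> B"
proof -
  have "compact (v ` K)" using assms by (meson compact_continuous_image continuous_on_subset top_greatest)
  then obtain B where "\<And>x. x \<in> K \<Longrightarrow> norm (v x) \<le> B"
    using compact_imp_bounded bounded_iff by (metis imageI)
  then have "norm (v x) \<le> max 0 B" for x using assms(3)[of x] by (cases "x \<in> K") (auto intro: max.coboundedI2)
  then show ?thesis by (intro that[of "max 0 B"]) auto
qed

text \<open>
  Testing with real-valued functions only serves the bilinear as well as the sesquilinear pairing.
\<close>

lemma weak_null_imp_AE_0:
  fixes \<Omega> :: "(real ^ 'n::finite) set"
  assumes "open \<Omega>" and g: "g \<in> L2 (lebesgue_on \<Omega>)"
    and test: "\<And>v. v \<in> test_functions \<Omega> \<Longrightarrow> (\<And>x. cnj (v x) = v x) \<Longrightarrow> (\<integral>x. g x * v x \<partial>lebesgue_on \<Omega>) = 0"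
  shows "AE x in lebesgue_on \<Omega>. g x = 0"
proof -
  have \<Omega>: "\<Omega> \<in> sets lebesgue" using \<open>open \<Omega>\<close> by auto
  have g_meas: "(\<lambda>x. indicator \<Omega> x *\<^sub>R g x) \<in> borel_measurable lebesgue"
    using g \<Omega> by (auto simp: L2_def borel_measurable_restrict_space_iff)
  have g_sq: "integrable lebesgue (\<lambda>x. indicator \<Omega> x *\<^sub>R (cmod (g x))\<^sup>2)"
    using g \<Omega> by (auto simp: L2_def integrable_restrict_space)
  \<comment> \<open>As \<Omega> may have infinite measure, a square-integrable \<open>g\<close> need
    not be integrable on it; on a bounded box it is dominated by \<open>1 + |g|^2\<close>.\<close>
  have box_int: "integrable lebesgue (\<lambda>x. indicator (cbox a b) x *\<^sub>R (indicator \<Omega> x *\<^sub>R g x))" for a b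
  proof (rule Bochner_Integration.integrable_bound)
    show "integrable lebesgue (\<lambda>x. indicator (cbox a b) x *\<^sub>R (1::real) + indicator \<Omega> x *\<^sub>R (cmod (g x))\<^sup>2)"
      using g_sq integrable_real_indicator[of "cbox a b" lebesgue]
      by (intro Bochner_Integration.integrable_add) (auto simp: emeasure_lborel_cbox_eq)
    have "t \<le> 1 + t\<^sup>2" for t :: real using zero_le_power2[of "t - 1/2"] by (simp add: power2_eq_square algebra_simps)
    then show "AE x in lebesgue. norm (indicator (cbox a b) x *\<^sub>R (indicator \<Omega> x *\<^sub>R g x))
       \<le> norm (indicator (cbox a b) x *\<^sub>R (1::real) + indicator \<Omega> x *\<^sub>R (cmod (g x))\<^sup>2)"
      by (auto simp: indicator_def)
    show "(\<lambda>x. indicator (cbox a b) x *\<^sub>R (indicator \<Omega> x *\<^sub>R g x)) \<in> borel_measurable lebesgue"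
      by (rule borel_measurable_scaleR[OF borel_measurable_indicator g_meas]) auto
  qed
  have box_0: "(\<integral>x. indicator (box a b) x *\<^sub>R (indicator \<Omega> x *\<^sub>R g x) \<partial>lebesgue) = 0"
    if ab: "cbox a b \<subseteq> \<Omega>" for a b
  proof -
    \<comment> \<open>The bumps tend to the indicator of the box and are bounded by 1; the majorant
      is \<open>|g|\<close> on the closed box.\<close>
    have "(\<lambda>n. \<integral>x. indicator \<Omega> x *\<^sub>R (g x * box_bump (real (Suc n)) a b x) \<partial>lebesgue)
       \<longlonglongrightarrow> (\<integral>x. indicator (box a b) x *\<^sub>R (indicator \<Omega> x *\<^sub>R g x) \<partial>lebesgue)"
    proof (rule integral_dominated_convergence)
      show "integrable lebesgue (\<lambda>x. norm (indicator (cbox a b) x *\<^sub>R (indicator \<Omega> x *\<^sub>R g x)))"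
        using box_int by (rule integrable_norm)
      have bm: "box_bump m a b \<in> borel_measurable lebesgue" for m
        using box_bump_Ck[of 0 m a b, THEN Ck_imp_continuous]
        by (intro measurable_completion) (auto intro: borel_measurable_continuous_onI)
      have "(\<lambda>x. (indicator \<Omega> x *\<^sub>R g x) * box_bump (real (Suc n)) a b x) \<in> borel_measurable lebesgue" for n
        using g_meas bm by (intro borel_measurable_times)
      then show "(\<lambda>x. indicator \<Omega> x *\<^sub>R (g x * box_bump (real (Suc n)) a b x)) \<in> borel_measurable lebesgue" for n
        by (simp del: of_nat_Suc)
      show "AE x in lebesgue. (\<lambda>n. indicator \<Omega> x *\<^sub>R (g x * box_bump (real (Suc n)) a b x))
         \<longlonglongrightarrow> indicator (box a b) x *\<^sub>R (indicator \<Omega> x *\<^sub>R g x)"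
      proof (rule AE_I2)
        fix x
        have "(\<lambda>n. indicator \<Omega> x *\<^sub>R (g x * box_bump (real (Suc n)) a b x))
          \<longlonglongrightarrow> indicator \<Omega> x *\<^sub>R (g x * indicator (box a b) x)"
          by (intro tendsto_intros box_bump_tendsto)
        moreover have "indicator \<Omega> x *\<^sub>R (g x * indicator (box a b) x)
            = indicator (box a b) x *\<^sub>R (indicator \<Omega> x *\<^sub>R g x)"
          by (simp add: indicator_def)
        ultimately show "(\<lambda>n. indicator \<Omega> x *\<^sub>R (g x * box_bump (real (Suc n)) a b x))
          \<longlonglongrightarrow> indicator (box a b) x *\<^sub>R (indicator \<Omega> x *\<^sub>R g x)"
          by (simp only:)
      qed
      show "AE x in lebesgue. norm (indicator \<Omega> x *\<^sub>R (g x * box_bump (real (Suc n)) a b x))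
        \<le> norm (indicator (cbox a b) x *\<^sub>R (indicator \<Omega> x *\<^sub>R g x))" for n
      proof (rule AE_I2)
        fix x
        show "norm (indicator \<Omega> x *\<^sub>R (g x * box_bump (real (Suc n)) a b x))
          \<le> norm (indicator (cbox a b) x *\<^sub>R (indicator \<Omega> x *\<^sub>R g x))"
        proof (cases "x \<in> cbox a b")
          case True
          then show ?thesis using norm_box_bump_le[of "real (Suc n)" a b x]
            by (auto simp: norm_mult indicator_def mult_left_le simp del: of_nat_Suc)
        next
          case False
          then have "box_bump (real (Suc n)) a b x = 0"
            using box_subset_cbox[of a b] by (intro box_bump_eq_0) auto
          then show ?thesis by simp
        qed
      qed
      show "(\<lambda>x. indicator (box a b) x *\<^sub>R (indicator \<Omega> x *\<^sub>R g x)) \<in> borel_measurable lebesgue"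
        by (rule borel_measurable_scaleR[OF borel_measurable_indicator g_meas]) auto
    qed
    moreover have "(\<integral>x. indicator \<Omega> x *\<^sub>R (g x * box_bump (real (Suc n)) a b x) \<partial>lebesgue) = 0" for n
    proof -
      have "cnj (box_bump (real (Suc n)) a b x) = box_bump (real (Suc n)) a b x" for x
        by (simp add: box_bump_def)
      then show ?thesis
        using test[OF box_bump_test_function[OF _ ab, of "real (Suc n)"]] \<Omega>
        by (simp add: integral_restrict_space del: of_nat_Suc)
    qed
    ultimately show ?thesis by (simp only: LIMSEQ_const_iff)
  qed
  have box_AE: "AE x in lebesgue. x \<in> box a b \<longrightarrow> g x = 0" if ab: "cbox a b \<subseteq> \<Omega>" for a b
  proof -
    let ?h = "\<lambda>x. indicator (box a b) x *\<^sub>R (indicator \<Omega> x *\<^sub>R g x)"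
    have "AE x in lebesgue. ?h x = 0"
    proof (rule lebesgue_null_boxes)
      have "integrable lebesgue (\<lambda>x. indicator (box a b) x *\<^sub>R (indicator (cbox a b) x *\<^sub>R (indicator \<Omega> x *\<^sub>R g x)))"
        by (rule integrable_mult_indicator[OF _ box_int]) auto
      moreover have "(\<lambda>x. indicator (box a b) x *\<^sub>R (indicator (cbox a b) x *\<^sub>R (indicator \<Omega> x *\<^sub>R g x))) = ?h"
        using box_subset_cbox[of a b] by (auto simp: indicator_def fun_eq_iff)
      ultimately show "integrable lebesgue ?h" by (simp only:)
      show "(\<integral>x. ?h x \<partial>lebesgue) = 0" by (rule box_0[OF ab])
      fix c d :: "real ^ 'n"
      obtain p q where pq: "box c d \<inter> box a b = box p q" by (rule that[OF box_Int_box])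
      have pq_iff: "x \<in> box p q \<longleftrightarrow> x \<in> box c d \<and> x \<in> box a b" for x using pq by blast
      show "(\<integral>x. indicator (box c d) x *\<^sub>R ?h x \<partial>lebesgue) = 0"
      \<comment> \<open>If \<open>box p q\<close> is empty, that says nothing about where
        \<open>cbox p q\<close> lies; otherwise \<open>cbox p q\<close> is its closure and stays
        inside \<Omega>.\<close>
      proof (cases "box p q = {}")
        case True
        then have "(\<lambda>x. indicator (box c d) x *\<^sub>R ?h x) = (\<lambda>x. 0)"
          using True pq_iff by (auto simp: indicator_def fun_eq_iff)
        then show ?thesis by (simp only: integral_zero)
      next
        case False
        have "box p q \<subseteq> box a b" using pq by blast
        then have "cbox p q \<subseteq> cbox a b"
          unfolding closure_box[OF False, symmetric] using box_subset_cbox[of a b]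
          by (intro closure_minimal closed_cbox) auto
        then have "cbox p q \<subseteq> \<Omega>" using ab by blast
        moreover have "(\<lambda>x. indicator (box c d) x *\<^sub>R ?h x) = (\<lambda>x. indicator (box p q) x *\<^sub>R (indicator \<Omega> x *\<^sub>R g x))"
          by (auto simp: indicator_def fun_eq_iff pq_iff)
        ultimately show ?thesis by (simp only: box_0)
      qed
    qed
    then show ?thesis
    proof eventually_elim
      case (elim x)
      then show ?case using ab box_subset_cbox[of a b] by (auto simp: indicator_def)
    qed
  qed
  \<comment> \<open>Each box carries its own exceptional null set; the Lindelof property leaves only
    countably many of them.\<close>
  define \<F> where "\<F> = {box a b | a b. cbox a b \<subseteq> \<Omega>}"
  obtain \<G> where \<G>: "\<G> \<subseteq> \<F>" "countable \<G>" "\<Union>\<G> = \<Union>\<F>"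
    using Lindelof[of \<F>] by (auto simp: \<F>_def)
  have ae: "AE x in lebesgue. \<forall>U\<in>\<G>. x \<in> U \<longrightarrow> g x = 0"
  proof (subst AE_ball_countable[OF \<G>(2)], rule ballI)
    fix U assume "U \<in> \<G>"
    then have "U \<in> \<F>" using \<G>(1) by blast
    then obtain a b where "U = box a b" "cbox a b \<subseteq> \<Omega>" unfolding \<F>_def by blast
    with box_AE[of a b] show "AE x in lebesgue. x \<in> U \<longrightarrow> g x = 0" by simp
  qed
  have cover: "\<exists>U\<in>\<G>. x \<in> U" if "x \<in> \<Omega>" for x
  proof -
    obtain e where e: "e > 0" "cball x e \<subseteq> \<Omega>"
      using \<open>open \<Omega>\<close> \<open>x \<in> \<Omega>\<close> unfolding open_contains_cball by blast
    obtain a b where ab: "x \<in> box a b" "box a b \<subseteq> ball x e"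
      using rational_boxes[OF e(1), of x] by blast
    have "box a b \<noteq> {}" using ab(1) by blast
    have "closure (box a b) \<subseteq> cball x e"
      by (rule closure_minimal[OF order_trans[OF ab(2) ball_subset_cball] closed_cball])
    then have "cbox a b \<subseteq> \<Omega>" using e(2) by (simp only: closure_box[OF \<open>box a b \<noteq> {}\<close>])
    then have "x \<in> \<Union>\<F>" using ab(1) unfolding \<F>_def by blast
    then show ?thesis unfolding \<G>(3)[symmetric] by blast
  qed
  have "AE x in lebesgue. x \<in> \<Omega> \<longrightarrow> g x = 0"
    using ae
  proof eventually_elim
    case (elim x)
    then show ?case using cover[of x] by blast
  qed
  then show ?thesis using \<Omega> by (simp add: AE_restrict_space_iff)
qed

section \<open>Integration by parts for test functions\<close>

lemma pdiff_eq_0_outside: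
  assumes "compact K" "\<And>x. x \<notin> K \<Longrightarrow> v x = 0" "x \<notin> K"
  shows "pdiff i v x = 0"
proof -
  have "open (- K)" using assms by (simp add: compact_imp_closed open_Compl)
  have "(v has_derivative (\<lambda>_. 0)) (at x)"
    by (rule has_derivative_transform_within_open[of "\<lambda>_. 0" _ _ _ "- K"])
       (use assms \<open>open (- K)\<close> in auto)
  then show ?thesis by (simp add: pdiff_eqI)
qed

text \<open>By translation invariance every difference quotient of \<open>F\<close> has integral 0.
  The mean value inequality bounds the quotients uniformly, and they vanish outside one compact set,
  so dominated convergence passes to the derivative.\<close>

lemma integral_pdiff_compact_support:
  fixes F :: "real ^ 'n::finite \<Rightarrow> complex"
  assumes diff: "\<And>x. F differentiable (at x)"
    and cont: "continuous_on UNIV (pdiff i F)"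
    and K: "compact K" "\<And>x. x \<notin> K \<Longrightarrow> F x = 0"
  shows "(\<integral>x. pdiff i F x \<partial>lborel) = 0"
proof -
  let ?e = "axis i 1 :: real ^ 'n"
  have F_meas: "F \<in> borel_measurable borel"
    using diff by (intro borel_measurable_continuous_onI) (auto intro!: differentiable_imp_continuous_within continuous_at_imp_continuous_on)
  have curve: "((\<lambda>t. F (x + t *\<^sub>R ?e)) has_vector_derivative pdiff i F (x + t *\<^sub>R ?e)) (at t)" for x t
  proof -
    have "((\<lambda>t. x + t *\<^sub>R ?e) has_derivative (\<lambda>h. h *\<^sub>R ?e)) (at t)"
      by (auto intro!: derivative_eq_intros)
    from has_derivative_compose[OF this] diff[of "x + t *\<^sub>R ?e"]
    have D: "((\<lambda>t. F (x + t *\<^sub>R ?e)) has_derivative (\<lambda>h. frechet_derivative F (at (x + t *\<^sub>R ?e)) (h *\<^sub>R ?e))) (at t)"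
      by (simp add: frechet_derivative_works)
    have "linear (frechet_derivative F (at (x + t *\<^sub>R ?e)))"
      using diff by (intro linear_frechet_derivative)
    with D show ?thesis by (simp add: has_vector_derivative_def pdiff_def linear_scale)
  qed
  \<comment> \<open>\<open>K\<close> is swept along the axis by at most 1 in both directions. The
    steps \<open>?t n\<close> are at most 1, so all difference quotients vanish outside
    \<open>K'\<close>.\<close>
  define K' where "K' = (\<lambda>(x, t). x + t *\<^sub>R ?e) ` (K \<times> {-1..1::real})"
  have K': "compact K'"
    unfolding K'_def
    by (intro compact_continuous_image compact_Times K) (auto intro!: continuous_intros simp: case_prod_beta)
  have "K \<subseteq> K'" by (force simp: K'_def image_iff intro: bexI[of _ "0::real"])
  obtain B where B: "0 \<le> B" "\<And>x. norm (pdiff i F x) \<le> B"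
    using compact_support_bounded[OF K(1) cont pdiff_eq_0_outside[OF K]] by blast
  let ?t = "\<lambda>n. inverse (real (Suc n))"
  let ?q = "\<lambda>n x. (F (x + ?t n *\<^sub>R ?e) - F x) /\<^sub>R ?t n"
  have F_int: "integrable lborel F"
  proof -
    have "continuous_on K F" using diff by (auto intro!: differentiable_imp_continuous_within continuous_at_imp_continuous_on)
    from borel_integrable_compact[OF K(1) this]
    have "integrable lborel (\<lambda>x. indicator K x *\<^sub>R F x)" .
    moreover have "(\<lambda>x. indicator K x *\<^sub>R F x) = F" using K(2) by (auto simp: indicator_def fun_eq_iff)
    ultimately show ?thesis by simp
  qed
  have shift: "integrable lborel (\<lambda>x. F (x + c)) \<and> (\<integral>x. F (x + c) \<partial>lborel) = (\<integral>x. F x \<partial>lborel)" for c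
  proof -
    have "integrable (distr lborel borel ((+) c)) F" using F_int by (simp add: lborel_distr_plus)
    moreover have "(\<integral>x. F x \<partial>lborel) = (\<integral>x. F x \<partial>(distr lborel borel ((+) c)))" by (simp add: lborel_distr_plus)
    ultimately show ?thesis
      using F_meas by (simp add: integrable_distr_eq integral_distr add.commute)
  qed
  have "(\<lambda>n. \<integral>x. ?q n x \<partial>lborel) \<longlonglongrightarrow> (\<integral>x. pdiff i F x \<partial>lborel)"
  proof (rule integral_dominated_convergence)
    show "integrable lborel (\<lambda>x. indicator K' x *\<^sub>R B)"
      using K' borel_integrable_compact[OF K', of "\<lambda>_. B"] by auto
    show "pdiff i F \<in> borel_measurable lborel"
      using cont by (simp add: borel_measurable_continuous_onI)
    show "?q n \<in> borel_measurable lborel" for n using F_meas by measurable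
    show "AE x in lborel. (\<lambda>n. ?q n x) \<longlonglongrightarrow> pdiff i F x"
    proof (rule AE_I2)
      fix x
      have "((\<lambda>h. (F (x + h *\<^sub>R ?e) - F x) /\<^sub>R h) \<longlongrightarrow> pdiff i F x) (at 0)"
      proof (subst Lim_null, rule tendsto_norm_zero_cancel)
        have lim: "((\<lambda>h. norm (F (x + h *\<^sub>R ?e) - F x - h *\<^sub>R pdiff i F x) / norm h) \<longlongrightarrow> 0) (at 0)"
          using curve[of x 0] by (simp add: has_vector_derivative_def has_derivative_at)
        have eq: "norm (F (x + h *\<^sub>R ?e) - F x - h *\<^sub>R pdiff i F x) / norm h
            = norm ((F (x + h *\<^sub>R ?e) - F x) /\<^sub>R h - pdiff i F x)" if "h \<noteq> 0" for h
        proof -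
          have "(F (x + h *\<^sub>R ?e) - F x) /\<^sub>R h - pdiff i F x
             = (F (x + h *\<^sub>R ?e) - F x - h *\<^sub>R pdiff i F x) /\<^sub>R h"
            using that by (simp add: scaleR_diff_right)
          then show ?thesis by (simp add: divide_inverse mult.commute)
        qed
        show "((\<lambda>h. norm ((F (x + h *\<^sub>R ?e) - F x) /\<^sub>R h - pdiff i F x)) \<longlongrightarrow> 0) (at 0)"
          by (rule Lim_transform_eventually[OF lim], unfold eventually_at_filter, rule always_eventually)
             (use eq in blast)
      qed
      then show "(\<lambda>n. ?q n x) \<longlonglongrightarrow> pdiff i F x"
        by (rule filterlim_compose) (use LIMSEQ_inverse_real_of_nat in \<open>auto simp: filterlim_at\<close>)
    qed
    show "AE x in lborel. norm (?q n x) \<le> indicator K' x *\<^sub>R B" for n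
    proof (rule AE_I2)
      fix x
      have t: "0 < ?t n" "?t n \<le> 1" "- 1 \<le> ?t n"
        by (simp_all add: field_simps order_trans[OF _ inverse_nonnegative_iff_nonnegative[THEN iffD2]])
      \<comment> \<open>The mean value inequality on the line through \<open>x\<close>, between the
        parameters 0 and \<open>?t n\<close>.\<close>
      have le: "norm (F (x + ?t n *\<^sub>R ?e) - F (x + 0 *\<^sub>R ?e)) \<le> B * norm (?t n - 0)"
        by (rule differentiable_bound[of UNIV "\<lambda>t. F (x + t *\<^sub>R ?e)" "\<lambda>t h. h *\<^sub>R pdiff i F (x + t *\<^sub>R ?e)"])
           (use curve B mult_right_mono[OF B(2) abs_ge_zero] in
              \<open>auto simp: has_vector_derivative_def mult.commute[of "\<bar>_\<bar>"] intro!: onorm_le\<close>)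
      have gen: "norm (z /\<^sub>R r) \<le> B" if "norm z \<le> B * r" "0 < r" for z :: complex and r
        using that by (simp add: field_simps)
      have "norm (?q n x) \<le> B"
        by (rule gen[OF _ t(1)])
           (use le in \<open>simp only: scaleR_zero_left add_0_right diff_zero real_norm_def abs_of_pos[OF t(1)]\<close>)
      moreover have "?q n x = 0" if "x \<notin> K'"
      proof -
        have "x + ?t n *\<^sub>R ?e \<notin> K"
        proof
          assume "x + ?t n *\<^sub>R ?e \<in> K"
          then have "(x + ?t n *\<^sub>R ?e) + (- ?t n) *\<^sub>R ?e \<in> K'"
            unfolding K'_def using t by (intro image_eqI[of _ _ "(x + ?t n *\<^sub>R ?e, - ?t n)"]) auto
          with that show False by simp
        qed
        with that \<open>K \<subseteq> K'\<close> K(2) show ?thesis by auto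
      qed
      ultimately show "norm (?q n x) \<le> indicator K' x *\<^sub>R B" by (auto simp: indicator_def)
    qed
  qed
  moreover have "(\<integral>x. ?q n x \<partial>lborel) = 0" for n
    using shift F_int by (simp del: of_nat_Suc)
  ultimately show ?thesis by (simp add: LIMSEQ_const_iff)
qed

lemma test_functionD:
  assumes "v \<in> test_functions \<Omega>"
  shows "v differentiable (at x)" "continuous_on UNIV (pdiff i v)" "x \<notin> \<Omega> \<Longrightarrow> v x = 0"
proof -
  have "Ck (Suc 0) v" using assms by (auto simp: test_functions_def)
  then show "v differentiable (at x)" "continuous_on UNIV (pdiff i v)" by auto
  show "x \<notin> \<Omega> \<Longrightarrow> v x = 0" using assms by (auto simp: test_functions_def)
qed

lemma compact_support_L2:
  fixes \<Omega> :: "'a::euclidean_space set"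
  assumes "\<Omega> \<in> sets lebesgue" "compact K" "continuous_on UNIV v" "\<And>x. x \<notin> K \<Longrightarrow> v x = 0"
  shows "v \<in> L2 (lebesgue_on \<Omega>)"
proof -
  have m: "v \<in> borel_measurable lebesgue"
    using assms(3) by (intro measurable_completion) (auto intro: borel_measurable_continuous_onI)
  have "integrable lborel (\<lambda>x. indicator K x *\<^sub>R (cmod (v x))\<^sup>2)"
    by (intro borel_integrable_compact assms continuous_intros continuous_on_subset[OF assms(3)]) auto
  moreover have "(\<lambda>x. indicator K x *\<^sub>R (cmod (v x))\<^sup>2) = (\<lambda>x. (cmod (v x))\<^sup>2)"
    using assms(4) by (auto simp: indicator_def fun_eq_iff)
  ultimately have "integrable lborel (\<lambda>x. (cmod (v x))\<^sup>2)" by simp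
  then have "integrable lebesgue (\<lambda>x. (cmod (v x))\<^sup>2)"
    by (subst integrable_completion) auto
  then have "integrable lebesgue (\<lambda>x. indicator \<Omega> x *\<^sub>R (cmod (v x))\<^sup>2)"
    using assms(1) by (intro integrable_mult_indicator)
  then show ?thesis
    using m assms(1) by (auto simp: L2_def integrable_restrict_space intro: measurable_restrict_space1)
qed

lemma test_function_L2:
  fixes \<Omega> :: "(real ^ 'n::finite) set"
  assumes "open \<Omega>" "v \<in> test_functions \<Omega>"
  shows "v \<in> L2 (lebesgue_on \<Omega>)" "pdiff i v \<in> L2 (lebesgue_on \<Omega>)"
proof -
  obtain K where K: "compact K" "\<And>x. x \<notin> K \<Longrightarrow> v x = 0"
    using assms(2) by (auto simp: test_functions_def)
  have \<Omega>: "\<Omega> \<in> sets lebesgue" using assms(1) by auto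
  show "v \<in> L2 (lebesgue_on \<Omega>)"
    using test_function_continuous[OF assms(2)] K by (intro compact_support_L2[OF \<Omega>]) auto
  show "pdiff i v \<in> L2 (lebesgue_on \<Omega>)"
    using test_functionD(2)[OF assms(2)] K by (intro compact_support_L2[OF \<Omega> K(1)] pdiff_eq_0_outside) auto
qed

text \<open>The product of two test functions has compact support, so its derivative integrates to
  0; the product rule splits this into the two sides of the identity.\<close>

lemma test_function_weak_partial:
  fixes \<Omega> :: "(real ^ 'n::finite) set"
  assumes "open \<Omega>" "v \<in> test_functions \<Omega>"
  shows "is_weak_partial \<Omega> i v (pdiff i v)"
  unfolding is_weak_partial_def
proof
  fix w assume w: "w \<in> test_functions \<Omega>"
  note v = test_functionD[OF assms(2)] and w = test_functionD[OF w]
  have v_cont: "continuous_on UNIV v" and w_cont: "continuous_on UNIV w"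
    using v(1) w(1) by (auto intro!: differentiable_imp_continuous_within continuous_at_imp_continuous_on)
  obtain K where K: "compact K" "K \<subseteq> \<Omega>" "\<And>x. x \<notin> K \<Longrightarrow> v x = 0"
    using assms(2) by (auto simp: test_functions_def)
  have \<Omega>: "\<Omega> \<in> sets lebesgue" using assms(1) by auto
  \<comment> \<open>A function vanishing off \<open>K\<close>, a subset of \<Omega>, has the same
    integral over \<Omega> as over the whole space; this moves the computation to
    \<open>lborel\<close>.\<close>
  have supp: "(\<integral>x. h x \<partial>lebesgue_on \<Omega>) = (\<integral>x. h x \<partial>lborel) \<and> integrable lborel h"
    if "continuous_on UNIV h" "\<And>x. x \<notin> K \<Longrightarrow> h x = 0" for h :: "real ^ 'n \<Rightarrow> complex"
  proof -
    have "(\<integral>x. h x \<partial>lebesgue_on \<Omega>) = (\<integral>x. indicator \<Omega> x *\<^sub>R h x \<partial>lebesgue)"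
      using \<Omega> by (simp add: integral_restrict_space)
    also have "(\<lambda>x. indicator \<Omega> x *\<^sub>R h x) = h" using that(2) K(2) by (auto simp: indicator_def fun_eq_iff)
    also have "(\<integral>x. h x \<partial>lebesgue) = (\<integral>x. h x \<partial>lborel)"
      using that(1) by (intro integral_completion) (simp add: borel_measurable_continuous_onI)
    moreover have "integrable lborel (\<lambda>x. indicator K x *\<^sub>R h x)"
      by (intro borel_integrable_compact K continuous_on_subset[OF that(1)]) auto
    moreover have "(\<lambda>x. indicator K x *\<^sub>R h x) = h" using that(2) by (auto simp: indicator_def fun_eq_iff)
    ultimately show ?thesis by simp
  qed
  have p0: "pdiff i v x = 0" if "x \<notin> K" for x
    by (rule pdiff_eq_0_outside[OF K(1,3) that])
  have c1: "continuous_on UNIV (\<lambda>x. v x * pdiff i w x)" and c2: "continuous_on UNIV (\<lambda>x. pdiff i v x * w x)"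
    by (intro continuous_intros v w v_cont w_cont)+
  have "(\<integral>x. pdiff i (\<lambda>x. v x * w x) x \<partial>lborel) = 0"
  proof (rule integral_pdiff_compact_support[OF _ _ K(1)])
    show "(\<lambda>x. v x * w x) differentiable at x" for x using v w by (intro differentiable_mult)
    show "continuous_on UNIV (pdiff i (\<lambda>x. v x * w x))"
    proof -
      have "pdiff i (\<lambda>x. v x * w x) = (\<lambda>x. v x * pdiff i w x + pdiff i v x * w x)"
        using v(1) w(1) by (auto simp: pdiff_mult)
      then show ?thesis using c1 c2 by (auto intro: continuous_on_add)
    qed
  qed (use K in auto)
  also have "(\<lambda>x. pdiff i (\<lambda>x. v x * w x) x) = (\<lambda>x. v x * pdiff i w x + pdiff i v x * w x)"
    using v(1) w(1) by (auto simp: pdiff_mult)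
  finally have "(\<integral>x. v x * pdiff i w x \<partial>lborel) + (\<integral>x. pdiff i v x * w x \<partial>lborel) = 0"
    using supp[OF c1] supp[OF c2] K p0 by (simp add: Bochner_Integration.integral_add)
  then show "(\<integral>x. v x * pdiff i w x \<partial>lebesgue_on \<Omega>) = - (\<integral>x. pdiff i v x * w x \<partial>lebesgue_on \<Omega>)"
    using supp[OF c1] supp[OF c2] K p0 by (simp add: add_eq_0_iff2)
qed

lemma test_functions_subset_H1:
  fixes \<Omega> :: "(real ^ 'n::finite) set"
  assumes "open \<Omega>"
  shows "test_functions \<Omega> \<subseteq> H1 \<Omega>"
  using test_function_L2[OF assms] test_function_weak_partial[OF assms] unfolding H1_def by blast

section \<open>Sectorial forms and square-integrable functions\<close>

text \<open>The best \<open>r\<close> would be \<open>sqrt B / sqrt A\<close>, which degenerates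
  when \<open>A\<close> or \<open>B\<close> is 0. Both roots are therefore shifted by some
  \<open>e > 0\<close>, which is sent to 0 at the end.\<close>

lemma le_2_sqrt_mult:
  fixes A B c :: real
  assumes "0 \<le> A" "0 \<le> B" and le: "\<And>r. 0 < r \<Longrightarrow> c \<le> r * A + B / r"
  shows "c \<le> 2 * sqrt A * sqrt B"
proof (rule tendsto_lowerbound)
  let ?f = "\<lambda>e. (sqrt B + e) * sqrt A + sqrt B * (sqrt A + e)"
  have "(?f \<longlongrightarrow> (sqrt B + 0) * sqrt A + sqrt B * (sqrt A + 0)) (at_right 0)"
    by (intro tendsto_intros)
  then show "(?f \<longlongrightarrow> 2 * sqrt A * sqrt B) (at_right 0)" by (simp add: mult.assoc)
  have "c \<le> ?f e" if "e > 0" for e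
  proof -
    have p: "0 < sqrt B + e" "0 < sqrt A + e" using assms that by (auto intro: add_nonneg_pos)
    let ?r = "(sqrt B + e) / (sqrt A + e)"
    have *: "x * x / (x + e) \<le> x" if "0 \<le> x" for x
      using that \<open>e > 0\<close> by (simp add: divide_simps mult_left_mono)
    have "?r * A = (sqrt B + e) * (sqrt A * sqrt A / (sqrt A + e))" using assms by simp
    also have "\<dots> \<le> (sqrt B + e) * sqrt A" using p assms by (intro mult_left_mono *) auto
    finally have "?r * A \<le> (sqrt B + e) * sqrt A" .
    moreover have "B / ?r = (sqrt A + e) * (sqrt B * sqrt B / (sqrt B + e))" using assms by simp
    moreover have "\<dots> \<le> (sqrt A + e) * sqrt B" using p assms by (intro mult_left_mono *) auto
    ultimately show ?thesis using le[of ?r] p by (simp add: mult.commute)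
  qed
  then show "\<forall>\<^sub>F e in at_right 0. c \<le> ?f e" by (auto simp: eventually_at_filter)
qed simp

text \<open>A convex hull without weights: the parallelogram law involves midpoints only, and
  induction carries every midpoint-convex bound from a tail to its hull.\<close>

inductive_set midhull :: "('x \<Rightarrow> complex) set \<Rightarrow> ('x \<Rightarrow> complex) set" for S where
  base: "u \<in> S \<Longrightarrow> u \<in> midhull S"
| mid: "u \<in> midhull S \<Longrightarrow> v \<in> midhull S \<Longrightarrow> (\<lambda>x. (u x + v x) / 2) \<in> midhull S"

lemma midhull_mono: "S \<subseteq> T \<Longrightarrow> midhull S \<subseteq> midhull T"
proof
  fix u assume "S \<subseteq> T" "u \<in> midhull S"
  from this(2,1) show "u \<in> midhull T" by induction (auto intro: midhull.intros)
qed

text \<open>The last two assumptions put the values on the diagonal into a sector of slope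
  \<open>K\<close> around the positive real axis. The L2 inner product, the Neumann form, the form
  \<open>a\<close> and the sums of the latter two with the inner product of \<Omega> are all
  instances, so each seminorm inequality is proved once.\<close>

locale sectorial_form =
  fixes D :: "('x \<Rightarrow> complex) set" and b :: "'x form" and K :: real
  assumes K_nonneg: "0 \<le> K"
    and add_mem: "u \<in> D \<Longrightarrow> v \<in> D \<Longrightarrow> (\<lambda>x. u x + v x) \<in> D"
    and scale_mem: "u \<in> D \<Longrightarrow> (\<lambda>x. z * u x) \<in> D"
    and add_left: "u \<in> D \<Longrightarrow> v \<in> D \<Longrightarrow> w \<in> D \<Longrightarrow> b (\<lambda>x. u x + v x) w = b u w + b v w"
    and add_right: "u \<in> D \<Longrightarrow> v \<in> D \<Longrightarrow> w \<in> D \<Longrightarrow> b w (\<lambda>x. u x + v x) = b w u + b w v"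
    and scale_left: "u \<in> D \<Longrightarrow> w \<in> D \<Longrightarrow> b (\<lambda>x. z * u x) w = z * b u w"
    and scale_right: "u \<in> D \<Longrightarrow> w \<in> D \<Longrightarrow> b w (\<lambda>x. z * u x) = cnj z * b w u"
    and Re_nonneg: "u \<in> D \<Longrightarrow> 0 \<le> Re (b u u)"
    and Im_le: "u \<in> D \<Longrightarrow> \<bar>Im (b u u)\<bar> \<le> K * Re (b u u)"
begin

abbreviation form_seminorm :: "('x \<Rightarrow> complex) \<Rightarrow> real" where
  "form_seminorm u \<equiv> sqrt (Re (b u u))"

lemma diff_mem: "u \<in> D \<Longrightarrow> v \<in> D \<Longrightarrow> (\<lambda>x. u x - v x) \<in> D"
  using add_mem[of u "\<lambda>x. - 1 * v x"] scale_mem[of v "-1"] by simp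

lemma mid_mem: "u \<in> D \<Longrightarrow> v \<in> D \<Longrightarrow> (\<lambda>x. (u x + v x) / 2) \<in> D"
  using scale_mem[OF add_mem[of u v], of "1/2"] by simp

lemma diff_left: "u \<in> D \<Longrightarrow> v \<in> D \<Longrightarrow> w \<in> D \<Longrightarrow> b (\<lambda>x. u x - v x) w = b u w - b v w"
  using add_left[of u "\<lambda>x. - 1 * v x" w] scale_left[of v w "-1"] scale_mem[of v "-1"] by simp

lemma diff_right: "u \<in> D \<Longrightarrow> v \<in> D \<Longrightarrow> w \<in> D \<Longrightarrow> b w (\<lambda>x. u x - v x) = b w u - b w v"
  using add_right[of u "\<lambda>x. - 1 * v x" w] scale_right[of v w "-1"] scale_mem[of v "-1"] by simp

lemma mid_left: "u \<in> D \<Longrightarrow> v \<in> D \<Longrightarrow> w \<in> D \<Longrightarrow> b (\<lambda>x. (u x + v x) / 2) w = (b u w + b v w) / 2"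
  using scale_left[OF add_mem[of u v], of w "1/2"] by (simp add: add_left)

lemma mid_right: "u \<in> D \<Longrightarrow> v \<in> D \<Longrightarrow> w \<in> D \<Longrightarrow> b w (\<lambda>x. (u x + v x) / 2) = (b w u + b w v) / 2"
  using scale_right[OF add_mem[of u v], of w "1/2"] by (simp add: add_right)

lemma expand:
  assumes "u \<in> D" "v \<in> D"
  shows "b (\<lambda>x. u x + z * v x) (\<lambda>x. u x + z * v x) = b u u + cnj z * b u v + z * b v u + z * cnj z * b v v"
  using assms scale_mem[OF assms(2), of z] add_mem[OF assms(1) scale_mem[OF assms(2), of z]]
  by (simp add: add_left add_right scale_left scale_right algebra_simps)

text \<open>Polarisation expresses \<open>4 * b u v\<close> by the diagonal at
  \<open>u + z * v\<close> for the four fourth roots of unity \<open>z\<close>, and on the diagonal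
  the modulus is at most \<open>1 + K\<close> times the real part.\<close>

lemma abs_le_sum: "u \<in> D \<Longrightarrow> v \<in> D \<Longrightarrow> cmod (b u v) \<le> (1 + K) * (Re (b u u) + Re (b v v))"
proof -
  assume uv: "u \<in> D" "v \<in> D"
  let ?B = "\<lambda>z. b (\<lambda>x. u x + z * v x) (\<lambda>x. u x + z * v x)"
  have le: "cmod (?B z) \<le> (1 + K) * Re (?B z)" for z
  proof -
    have "(\<lambda>x. u x + z * v x) \<in> D" using uv by (intro add_mem scale_mem)
    then have "0 \<le> Re (?B z)" "\<bar>Im (?B z)\<bar> \<le> K * Re (?B z)" by (rule Re_nonneg Im_le)+
    then show ?thesis using cmod_le[of "?B z"] by (simp add: algebra_simps)
  qed
  have "4 * b u v = ?B 1 - ?B (-1) + \<i> * ?B \<i> - \<i> * ?B (-\<i>)"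
    unfolding expand[OF uv] by (simp add: algebra_simps)
  then have "4 * cmod (b u v) = cmod (?B 1 - ?B (-1) + \<i> * ?B \<i> - \<i> * ?B (-\<i>))"
    by (metis norm_mult norm_numeral)
  also have "\<dots> \<le> cmod (?B 1) + cmod (?B (-1)) + cmod (\<i> * ?B \<i>) + cmod (\<i> * ?B (-\<i>))"
    by (intro norm_triangle_le_diff norm_triangle_le add_mono order_refl)
  also have "\<dots> = cmod (?B 1) + cmod (?B (-1)) + cmod (?B \<i>) + cmod (?B (-\<i>))"
    by (simp only: norm_mult norm_ii mult_1)
  also have "\<dots> \<le> (1 + K) * (Re (?B 1) + Re (?B (-1)) + Re (?B \<i>) + Re (?B (-\<i>)))"
    using le[of 1] le[of "-1"] le[of \<i>] le[of "-\<i>"] by (simp only: distrib_left)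
  also have "Re (?B 1) + Re (?B (-1)) + Re (?B \<i>) + Re (?B (-\<i>)) = 4 * (Re (b u u) + Re (b v v))"
    unfolding expand[OF uv] by simp
  also have "(1 + K) * (4 * (Re (b u u) + Re (b v v))) = 4 * ((1 + K) * (Re (b u u) + Re (b v v)))"
    by (rule mult.left_commute)
  finally show ?thesis by (simp only: mult_le_cancel_left_pos zero_less_numeral)
qed

text \<open>Replacing \<open>u\<close> by \<open>t * u\<close> and \<open>v\<close> by
  \<open>v / t\<close> leaves \<open>b u v\<close> unchanged and puts the weights
  \<open>r = t^2\<close> and \<open>1 / r\<close> into the sum bound; optimising over
  \<open>r\<close> gives the product.\<close>

lemma abs_le: "u \<in> D \<Longrightarrow> v \<in> D \<Longrightarrow> cmod (b u v) \<le> 2 * (1 + K) * (form_seminorm u * form_seminorm v)"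
proof -
  assume uv: "u \<in> D" "v \<in> D"
  have "cmod (b u v) / (1 + K) \<le> 2 * form_seminorm u * form_seminorm v"
  proof (rule le_2_sqrt_mult)
    fix r :: real assume "0 < r"
    define t where "t = sqrt r"
    have t: "0 < t" "r = t * t" using \<open>0 < r\<close> by (auto simp: t_def)
    let ?u = "\<lambda>x. complex_of_real t * u x" and ?v = "\<lambda>x. complex_of_real (1 / t) * v x"
    have m: "?u \<in> D" "?v \<in> D" by (intro scale_mem uv)+
    have "cmod (b ?u ?v) \<le> (1 + K) * (Re (b ?u ?u) + Re (b ?v ?v))" by (rule abs_le_sum[OF m])
    also have "b ?u ?v = b u v" using uv m t by (simp only: scale_left scale_right) simp
    also have "b ?u ?u = complex_of_real (t * t) * b u u" using uv m by (simp only: scale_left scale_right) simp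
    also have "b ?v ?v = complex_of_real (1 / (t * t)) * b v v" using uv m by (simp only: scale_left scale_right) simp
    finally show "cmod (b u v) / (1 + K) \<le> r * Re (b u u) + Re (b v v) / r"
      using K_nonneg t by (simp add: field_simps)
  qed (use uv Re_nonneg in auto)
  then show ?thesis using K_nonneg by (simp add: field_simps)
qed

text \<open>Cauchy-Schwarz for the symmetric part, from nonnegativity at \<open>u - v / r\<close>.
  The constant has to be sharp: the larger one in \<open>abs_le\<close> would not give the triangle
  inequality.\<close>

lemma Re_sym_le:
  assumes uv: "u \<in> D" "v \<in> D"
  shows "Re (b u v) + Re (b v u) \<le> 2 * form_seminorm u * form_seminorm v"
proof (rule le_2_sqrt_mult)
  fix r :: real assume "0 < r"
  define t where "t = sqrt r"
  have t: "0 < t" "r = t * t" using \<open>0 < r\<close> by (auto simp: t_def)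
  let ?w = "\<lambda>x. u x + complex_of_real (- 1 / r) * v x"
  have "?w \<in> D" using uv by (intro add_mem scale_mem)
  then have "0 \<le> Re (b ?w ?w)" by (rule Re_nonneg)
  then have "0 \<le> r * Re (b ?w ?w)" using \<open>0 < r\<close> by simp
  moreover have "Re (b ?w ?w) = Re (b u u) - (Re (b u v) + Re (b v u)) / r + Re (b v v) / (r * r)"
    unfolding expand[OF uv] by (simp add: add_divide_distrib)
  moreover have "r * (x - y / r + z / (r * r)) = r * x - y + z / r" for x y z :: real
    using \<open>0 < r\<close> by (simp add: field_simps)
  ultimately show "Re (b u v) + Re (b v u) \<le> r * Re (b u u) + Re (b v v) / r"
    by simp
qed (use uv Re_nonneg in auto)

lemma seminorm_triangle:
  assumes uv: "u \<in> D" "v \<in> D"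
  shows "form_seminorm (\<lambda>x. u x + v x) \<le> form_seminorm u + form_seminorm v"
proof (rule real_le_lsqrt)
  have "Re (b (\<lambda>x. u x + v x) (\<lambda>x. u x + v x)) = Re (b u u) + (Re (b u v) + Re (b v u)) + Re (b v v)"
    using expand[OF uv, of 1] by simp
  also have "\<dots> \<le> (form_seminorm u + form_seminorm v)\<^sup>2"
    using Re_sym_le[OF uv] Re_nonneg uv by (simp add: power2_sum)
  finally show "Re (b (\<lambda>x. u x + v x) (\<lambda>x. u x + v x)) \<le> (form_seminorm u + form_seminorm v)\<^sup>2" .
qed (use uv Re_nonneg in auto)

lemma seminorm_minus_commute:
  assumes uv: "u \<in> D" "v \<in> D"
  shows "form_seminorm (\<lambda>x. u x - v x) = form_seminorm (\<lambda>x. v x - u x)"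
proof -
  have "(\<lambda>x. u x - v x) = (\<lambda>x. - 1 * (v x - u x))" by simp
  then show ?thesis
    using diff_mem[OF uv(2,1)] scale_mem[OF diff_mem[OF uv(2,1)], of "-1"]
      scale_left[of "\<lambda>x. v x - u x" "\<lambda>x. - 1 * (v x - u x)" "-1"] scale_right[of "\<lambda>x. v x - u x" "\<lambda>x. v x - u x" "-1"]
    by simp
qed

lemma seminorm_dist_triangle:
  assumes "u \<in> D" "v \<in> D" "w \<in> D"
  shows "form_seminorm (\<lambda>x. u x - w x) \<le> form_seminorm (\<lambda>x. u x - v x) + form_seminorm (\<lambda>x. v x - w x)"
  using seminorm_triangle[OF diff_mem[OF assms(1,2)] diff_mem[OF assms(2,3)]] by simp

lemma seminorm_triangle_diff:
  assumes "u \<in> D" "v \<in> D"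
  shows "\<bar>form_seminorm u - form_seminorm v\<bar> \<le> form_seminorm (\<lambda>x. u x - v x)"
  using seminorm_triangle[OF diff_mem[OF assms] assms(2)] seminorm_triangle[OF diff_mem[OF assms(2,1)] assms(1)]
    seminorm_minus_commute[OF assms] by simp

lemma seminorm_half:
  assumes "u \<in> D"
  shows "form_seminorm (\<lambda>x. u x / 2) = form_seminorm u / 2"
proof -
  have "b (\<lambda>x. (1/2) * u x) (\<lambda>x. (1/2) * u x) = (1/2) * ((1/2) * b u u)"
    using scale_left[OF assms scale_mem[OF assms, of "1/2"], of "1/2"] scale_right[OF assms assms, of "1/2"]
    by (simp only:) simp
  then have "b (\<lambda>x. u x / 2) (\<lambda>x. u x / 2) = (1 / 4) *\<^sub>R b u u" by (simp add: scaleR_conv_of_real)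
  then have "Re (b (\<lambda>x. u x / 2) (\<lambda>x. u x / 2)) = Re (b u u) / 4" by (simp only: scaleR_complex.sel)
  then show ?thesis by (simp only: real_sqrt_divide real_sqrt_four)
qed

text \<open>The mixed terms \<open>b u v\<close> and \<open>b v u\<close> cancel whether or not
  \<open>b\<close> is symmetric. In this form, two elements whose energies barely exceed that of
  their midpoint must be close to each other.\<close>

lemma parallelogram:
  assumes uv: "u \<in> D" "v \<in> D"
  shows "Re (b (\<lambda>x. u x - v x) (\<lambda>x. u x - v x))
    = 2 * Re (b u u) + 2 * Re (b v v) - 4 * Re (b (\<lambda>x. (u x + v x) / 2) (\<lambda>x. (u x + v x) / 2))"
proof -
  have "Re (b (\<lambda>x. u x - v x) (\<lambda>x. u x - v x)) = Re (b u u) - Re (b u v) - Re (b v u) + Re (b v v)"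
    using expand[OF uv, of "-1"] by simp
  then show ?thesis
    unfolding mid_left[OF uv mid_mem[OF uv]] mid_right[OF uv uv(1)] mid_right[OF uv uv(2)]
    by (simp add: field_simps)
qed

lemma midhull_mem:
  assumes "u \<in> midhull S" "S \<subseteq> D"
  shows "u \<in> D"
  using assms by induction (auto intro: mid_mem)

text \<open>
  A replacement for weak compactness: almost minimal elements of the decreasing midpoint hulls of
  the tails form a Cauchy sequence by the parallelogram law.
\<close>

lemma bounded_imp_midhull_Cauchy:
  fixes s :: "nat \<Rightarrow> 'x \<Rightarrow> complex"
  assumes s: "\<And>n. s n \<in> D" and B: "\<And>n. Re (b (s n) (s n)) \<le> B"
  obtains w where "\<And>n. w n \<in> midhull (s ` {n..})"
    and "\<And>e. 0 < e \<Longrightarrow> \<exists>N. \<forall>m\<ge>N. \<forall>n\<ge>N. form_seminorm (\<lambda>x. w m x - w n x) < e"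
proof -
  define q where "q = (\<lambda>u. Re (b u u))"
  define H where "H = (\<lambda>n. midhull (s ` {n..}))"
  \<comment> \<open>The infimum of the energy on the hull of the tail from \<open>n\<close>. It
    increases because the hulls shrink, and the bound \<open>B\<close> makes it converge.\<close>
  define d where "d = (\<lambda>n. Inf (q ` H n))"
  have HD: "H n \<subseteq> D" for n using s midhull_mem unfolding H_def by blast
  have bdd: "bdd_below (q ` H n)" for n
    by (rule bdd_belowI[of _ 0]) (use HD Re_nonneg in \<open>auto simp: q_def\<close>)
  have sH: "s n \<in> H n" for n by (auto simp: H_def intro: midhull.base)
  have d_le: "d n \<le> q u" if "u \<in> H n" for n u
    unfolding d_def using bdd that by (auto intro: cInf_lower)
  have H_mono: "H n \<subseteq> H m" if "m \<le> n" for m n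
    unfolding H_def using that by (intro midhull_mono) auto
  have "incseq d"
    unfolding d_def by (intro incseq_SucI cInf_superset_mono bdd image_mono H_mono) (use sH in auto)
  have "d n \<le> B" for n using d_le[OF sH] B unfolding q_def by (meson order_trans)
  obtain L where L: "d \<longlonglongrightarrow> L" "\<And>n. d n \<le> L"
    using incseq_convergent[OF \<open>incseq d\<close>, of B] \<open>\<And>n. d n \<le> B\<close> by blast
  have "\<exists>u\<in>H n. q u < d n + 1 / real (Suc n)" for n
    using cInf_lessD[of "q ` H n" "d n + 1 / real (Suc n)"] sH[of n] by (auto simp: d_def)
  then obtain w where w: "\<And>n. w n \<in> H n" "\<And>n. q (w n) < d n + 1 / real (Suc n)" by metis
  \<comment> \<open>For \<open>n \<le> m\<close> and \<open>r = 1 / Suc n\<close> one has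
    \<open>q (w m) < L + r\<close> and \<open>q (w n) < d n + r\<close>, while the midpoint has
    energy at least \<open>d n\<close>; the parallelogram law then leaves
    \<open>2 * (L + r) + 2 * (d n + r) - 4 * d n\<close>.\<close>
  define \<epsilon> where "\<epsilon> = (\<lambda>n. 2 * (L - d n) + 4 * (1 / real (Suc n)))"
  have le: "q (\<lambda>x. w m x - w n x) \<le> \<epsilon> n" if "n \<le> m" for m n
  proof -
    \<comment> \<open>The later element lies in the larger hull \<open>H n\<close> too, which
      therefore contains the midpoint and allows the comparison with \<open>d n\<close>.\<close>
    have mem: "w m \<in> H n" using w(1) H_mono[OF that] by blast
    then have "(\<lambda>x. (w m x + w n x) / 2) \<in> H n" using w(1)[of n] by (auto simp: H_def intro: midhull.mid)
    then have "d n \<le> q (\<lambda>x. (w m x + w n x) / 2)" by (rule d_le)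
    moreover have "q (\<lambda>x. w m x - w n x) = 2 * q (w m) + 2 * q (w n) - 4 * q (\<lambda>x. (w m x + w n x) / 2)"
      unfolding q_def by (rule parallelogram) (use w(1) HD in blast)+
    moreover have "1 / real (Suc m) \<le> 1 / real (Suc n)" using that by (simp add: field_simps)
    moreover have "qd \<le> 2 * (L' - dn) + 4 * r"
      if "dn \<le> qm" "qd = 2 * q1 + 2 * q2 - 4 * qm" "r' \<le> r" "q1 < dm + r'" "q2 < dn + r" "dm \<le> L'"
      for dn dm qm qd q1 q2 r r' L' :: real using that by argo
    ultimately show ?thesis using w(2)[of m] w(2)[of n] L(2)[of m] unfolding \<epsilon>_def by blast
  qed
  have "\<epsilon> \<longlonglongrightarrow> 2 * (L - L) + 4 * 0"
    unfolding \<epsilon>_def by (intro tendsto_intros L LIMSEQ_Suc[OF lim_1_over_n])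
  then have \<epsilon>: "\<epsilon> \<longlonglongrightarrow> 0" by simp
  show ?thesis
  proof (rule that)
    show "w n \<in> midhull (s ` {n..})" for n using w(1) by (simp add: H_def)
    fix e :: real assume "0 < e"
    then have "eventually (\<lambda>n. \<epsilon> n < e\<^sup>2) sequentially" by (intro order_tendstoD[OF \<epsilon>]) simp
    then obtain N where N: "\<And>n. n \<ge> N \<Longrightarrow> \<epsilon> n < e\<^sup>2" by (auto simp: eventually_sequentially)
    have *: "form_seminorm (\<lambda>x. w m x - w n x) < e" if "N \<le> n" "n \<le> m" for m n
      using le[OF that(2)] N[OF that(1)] \<open>0 < e\<close> unfolding q_def by (intro real_less_lsqrt) auto
    have wD: "w n \<in> D" for n using w(1) HD by blast
    have "form_seminorm (\<lambda>x. w m x - w n x) < e" if "N \<le> n" "N \<le> m" for m n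
      using *[of n m] *[of m n] that seminorm_minus_commute[OF wD wD, of n m] by (cases "n \<le> m") auto
    then show "\<exists>N. \<forall>m\<ge>N. \<forall>n\<ge>N. form_seminorm (\<lambda>x. w m x - w n x) < e" by blast
  qed
qed

end

section \<open>Inner product and completeness of L2\<close>

lemma L2_mult_integrable:
  assumes u: "u \<in> L2 M" and v: "v \<in> L2 M"
  shows "integrable M (\<lambda>x. u x * v x)"
proof (rule Bochner_Integration.integrable_bound)
  show "integrable M (\<lambda>x. (cmod (u x))\<^sup>2 + (cmod (v x))\<^sup>2)"
    using u v by (auto simp: L2_def)
  have "a * b \<le> a\<^sup>2 + b\<^sup>2" for a b :: real
    using sum_squares_bound[of a b] zero_le_square[of a] zero_le_square[of b]
    by (cases "0 \<le> a * b") (auto simp: power2_eq_square intro: order_trans[of _ 0])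
  then show "AE x in M. norm (u x * v x) \<le> norm ((cmod (u x))\<^sup>2 + (cmod (v x))\<^sup>2)"
    by (auto simp: norm_mult)
  show "(\<lambda>x. u x * v x) \<in> borel_measurable M"
    using u v by (auto simp: L2_def intro: borel_measurable_times)
qed

lemma L2_cnj: "u \<in> L2 M \<Longrightarrow> (\<lambda>x. cnj (u x)) \<in> L2 M"
  using measurable_compose[OF _ borel_measurable_continuous_onI[OF continuous_on_cnj[OF continuous_on_id]]]
  by (auto simp: L2_def)

lemma L2_inner_integrable: "u \<in> L2 M \<Longrightarrow> v \<in> L2 M \<Longrightarrow> integrable M (\<lambda>x. u x * cnj (v x))"
  by (intro L2_mult_integrable L2_cnj)

lemma L2_add:
  assumes "u \<in> L2 M" "v \<in> L2 M"
  shows "(\<lambda>x. u x + v x) \<in> L2 M"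
proof -
  have [measurable]: "u \<in> borel_measurable M" "v \<in> borel_measurable M" using assms by (auto simp: L2_def)
  have "integrable M (\<lambda>x. (cmod (u x + v x))\<^sup>2)"
  proof (rule Bochner_Integration.integrable_bound)
    show "integrable M (\<lambda>x. 2 * (cmod (u x))\<^sup>2 + 2 * (cmod (v x))\<^sup>2)"
      using assms by (auto simp: L2_def)
    have "(cmod (y + z))\<^sup>2 \<le> 2 * (cmod y)\<^sup>2 + 2 * (cmod z)\<^sup>2" for y z
    proof -
      have "(cmod (y + z))\<^sup>2 \<le> (cmod y + cmod z)\<^sup>2" by (simp add: norm_triangle_ineq power_mono)
      also have "\<dots> \<le> 2 * (cmod y)\<^sup>2 + 2 * (cmod z)\<^sup>2"
        using sum_squares_bound[of "cmod y" "cmod z"] by (simp add: power2_sum)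
      finally show ?thesis .
    qed
    then show "AE x in M. norm ((cmod (u x + v x))\<^sup>2) \<le> norm (2 * (cmod (u x))\<^sup>2 + 2 * (cmod (v x))\<^sup>2)"
      by auto
  qed measurable
  then show ?thesis by (simp add: L2_def)
qed

lemma L2_scale: "u \<in> L2 M \<Longrightarrow> (\<lambda>x. z * u x) \<in> L2 M"
  by (auto simp: L2_def norm_mult power_mult_distrib)

lemma L2_inner_self: "L2_inner M u u = complex_of_real (\<integral>x. (cmod (u x))\<^sup>2 \<partial>M)"
  unfolding L2_inner_def complex_norm_square[symmetric] by (rule integral_complex_of_real)

lemma L2_norm_eq: "L2_norm M u = sqrt (Re (L2_inner M u u))"
  by (simp add: L2_norm_def L2_inner_self)

lemma L2_norm_sq: "(L2_norm M u)\<^sup>2 = Re (L2_inner M u u)"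
  by (simp add: L2_norm_def L2_inner_self)

text \<open>The diagonal of the inner product is real, hence the constant 0. The general
  inequalities become those of the L2 norm, including Cauchy-Schwarz up to a factor 2.\<close>

interpretation L2: sectorial_form "L2 M" "L2_inner M" 0
proof
  fix u v w :: "'a \<Rightarrow> complex" and z :: complex
  show "L2_inner M (\<lambda>x. u x + v x) w = L2_inner M u w + L2_inner M v w" if "u \<in> L2 M" "v \<in> L2 M" "w \<in> L2 M"
    unfolding L2_inner_def distrib_right
    using that by (intro Bochner_Integration.integral_add L2_inner_integrable)
  show "L2_inner M w (\<lambda>x. u x + v x) = L2_inner M w u + L2_inner M w v" if "u \<in> L2 M" "v \<in> L2 M" "w \<in> L2 M"
    unfolding L2_inner_def complex_cnj_add distrib_left
    using that by (intro Bochner_Integration.integral_add L2_inner_integrable)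
  show "L2_inner M (\<lambda>x. z * u x) w = z * L2_inner M u w"
    unfolding L2_inner_def by (simp add: mult.assoc)
  have "(\<lambda>x. w x * cnj (z * u x)) = (\<lambda>x. cnj z * (w x * cnj (u x)))" by (auto simp: ac_simps)
  then show "L2_inner M w (\<lambda>x. z * u x) = cnj z * L2_inner M w u"
    unfolding L2_inner_def by simp
qed (auto simp: L2_inner_self intro: L2_add L2_scale)

lemmas L2_norm_triangle = L2.seminorm_triangle[folded L2_norm_eq]
  and L2_norm_minus_commute = L2.seminorm_minus_commute[folded L2_norm_eq]
  and L2_norm_dist_triangle = L2.seminorm_dist_triangle[folded L2_norm_eq]
  and L2_norm_triangle_diff = L2.seminorm_triangle_diff[folded L2_norm_eq]
  and L2_norm_half = L2.seminorm_half[folded L2_norm_eq]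
  and L2_inner_le = L2.abs_le[folded L2_norm_eq]

lemma L2_norm_nonneg: "0 \<le> L2_norm M u"
  by (simp add: L2_norm_def)

lemma L2_norm_eq_0_imp_AE: "u \<in> L2 M \<Longrightarrow> L2_norm M u = 0 \<Longrightarrow> AE x in M. u x = 0"
  using integral_nonneg_eq_0_iff_AE[of M "\<lambda>x. (cmod (u x))\<^sup>2"] by (auto simp: L2_def L2_norm_def)

lemma nn_integral_L2_norm:
  "u \<in> L2 M \<Longrightarrow> (\<integral>\<^sup>+x. ennreal ((cmod (u x))\<^sup>2) \<partial>M) = ennreal ((L2_norm M u)\<^sup>2)"
  by (simp add: L2_def L2_norm_def nn_integral_eq_integral)

text \<open>Weighting the squared increments by \<open>4 ^ k\<close> makes them summable pointwise almost everywhere.\<close>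

lemma L2_complete:
  assumes s: "\<And>n. s n \<in> L2 M"
    and Cauchy: "\<And>e. 0 < e \<Longrightarrow> \<exists>N. \<forall>m\<ge>N. \<forall>n\<ge>N. L2_norm M (\<lambda>x. s m x - s n x) < e"
  obtains \<phi> where "\<phi> \<in> L2 M" "L2_tendsto M s \<phi>"
proof -
  have [measurable]: "s n \<in> borel_measurable M" for n using s by (auto simp: L2_def)
  have d: "(\<lambda>x. s m x - s n x) \<in> L2 M" for m n by (rule L2.diff_mem[OF s s])
  \<comment> \<open>The rate is matched to the weights: the square of \<open>(1/4) ^ k\<close> times
    \<open>4 ^ k\<close> is again \<open>(1/4) ^ k\<close>, which is summable.\<close>
  have "\<forall>k. \<exists>N. \<forall>m\<ge>N. \<forall>n\<ge>N. L2_norm M (\<lambda>x. s m x - s n x) < (1/4) ^ k"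
    using Cauchy by simp
  then obtain N where N: "\<And>k m n. N k \<le> m \<Longrightarrow> N k \<le> n \<Longrightarrow> L2_norm M (\<lambda>x. s m x - s n x) < (1/4) ^ k"
    by metis
  \<comment> \<open>Summing the thresholds makes \<open>r k\<close> and \<open>r (Suc k)\<close> at
    least \<open>N k\<close>; the summand \<open>k\<close> sends \<open>r k\<close> to infinity, as
    the Fatou estimate requires.\<close>
  define r where "r = (\<lambda>k. k + (\<Sum>j\<le>k. N j))"
  have rN: "N k \<le> r k" "N k \<le> r (Suc k)" for k
    using member_le_sum[of k "{..k}" N] by (auto simp: r_def)
  define \<delta> where "\<delta> = (\<lambda>k x. s (r (Suc k)) x - s (r k) x)"
  have [measurable]: "\<delta> k \<in> borel_measurable M" for k unfolding \<delta>_def by measurable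
  have "(\<integral>\<^sup>+x. (\<Sum>k. ennreal (4 ^ k) * ennreal ((cmod (\<delta> k x))\<^sup>2)) \<partial>M)
      = (\<Sum>k. \<integral>\<^sup>+x. ennreal (4 ^ k) * ennreal ((cmod (\<delta> k x))\<^sup>2) \<partial>M)"
    by (rule nn_integral_suminf) measurable
  also have "\<dots> = (\<Sum>k. ennreal (4 ^ k * (L2_norm M (\<delta> k))\<^sup>2))"
    using nn_integral_L2_norm[OF d] unfolding \<delta>_def
    by (subst nn_integral_cmult) (auto simp: ennreal_mult)
  also have "\<dots> \<le> (\<Sum>k. ennreal ((1/4) ^ k))"
  proof (intro suminf_le ennreal_leI summableI)
    fix k
    have "(L2_norm M (\<delta> k))\<^sup>2 \<le> ((1/4) ^ k)\<^sup>2"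
      using N[OF rN(2,1), of k] L2_norm_nonneg unfolding \<delta>_def by (intro power_mono) auto
    then have "4 ^ k * (L2_norm M (\<delta> k))\<^sup>2 \<le> 4 ^ k * ((1/4) ^ k)\<^sup>2" by (rule mult_left_mono) simp
    also have "\<dots> = (1/4::real) ^ k" by (simp only: power2_eq_square power_mult_distrib[symmetric]) simp
    finally show "4 ^ k * (L2_norm M (\<delta> k))\<^sup>2 \<le> (1/4) ^ k" .
  qed
  also have "\<dots> < \<infinity>"
    by (subst suminf_ennreal_eq[OF _ geometric_sums]) auto
  finally have fin: "AE x in M. (\<Sum>k. ennreal (4 ^ k) * ennreal ((cmod (\<delta> k x))\<^sup>2)) \<noteq> \<infinity>"
    by (intro nn_integral_PInf_AE) auto
  have conv: "AE x in M. convergent (\<lambda>k. s (r k) x)"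
    using fin
  proof eventually_elim
    case (elim x)
    then obtain C where C: "0 \<le> C" "(\<Sum>k. ennreal (4 ^ k) * ennreal ((cmod (\<delta> k x))\<^sup>2)) = ennreal C"
      by (cases "\<Sum>k. ennreal (4 ^ k) * ennreal ((cmod (\<delta> k x))\<^sup>2)") auto
    have "cmod (\<delta> k x) \<le> sqrt C * (1/2) ^ k" for k
    proof -
      have "ennreal (4 ^ k * (cmod (\<delta> k x))\<^sup>2) \<le> ennreal C"
        unfolding C(2)[symmetric]
        using sum_le_suminf[of "\<lambda>k. ennreal (4 ^ k) * ennreal ((cmod (\<delta> k x))\<^sup>2)" "{k}"]
        by (auto simp: ennreal_mult)
      then have "4 ^ k * (cmod (\<delta> k x))\<^sup>2 \<le> C" using C(1) by (simp add: ennreal_le_iff)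
      then have "(2 ^ k * cmod (\<delta> k x))\<^sup>2 \<le> C"
        by (simp add: power_mult_distrib power2_eq_square[of "2 ^ k"] power_mult_distrib[symmetric])
      then have "2 ^ k * cmod (\<delta> k x) \<le> sqrt C" by (rule real_le_rsqrt)
      then show ?thesis by (simp add: field_simps power_divide)
    qed
    then have "summable (\<lambda>k. \<delta> k x)"
      by (intro summable_comparison_test[of "\<lambda>k. \<delta> k x" "\<lambda>k. sqrt C * (1/2) ^ k"] exI[of _ 0])
         (auto intro!: summable_mult summable_geometric)
    then have "convergent (\<lambda>n. \<Sum>k<n. \<delta> k x)" by (simp add: summable_iff_convergent)
    then have "convergent (\<lambda>n. s (r 0) x + (\<Sum>k<n. \<delta> k x))" by (intro convergent_add convergent_const)
    moreover have "(\<lambda>n. s (r 0) x + (\<Sum>k<n. \<delta> k x)) = (\<lambda>n. s (r n) x)"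
      unfolding \<delta>_def by (subst sum_lessThan_telescope) auto
    ultimately show ?case by simp
  qed
  \<comment> \<open>On the null set without convergence \<open>lim\<close> takes an unspecified
    value; \<phi> is measurable all the same.\<close>
  define \<phi> where "\<phi> = (\<lambda>x. lim (\<lambda>k. s (r k) x))"
  have [measurable]: "\<phi> \<in> borel_measurable M" unfolding \<phi>_def by measurable
  have limit: "AE x in M. (\<lambda>k. s (r k) x) \<longlonglongrightarrow> \<phi> x"
    using conv unfolding \<phi>_def by eventually_elim (simp add: convergent_LIMSEQ_iff)
  have Fatou: "(\<integral>\<^sup>+x. ennreal ((cmod (s n x - \<phi> x))\<^sup>2) \<partial>M) \<le> ennreal (e\<^sup>2)"
    if e: "0 < e" and n: "\<And>m. m0 \<le> m \<Longrightarrow> L2_norm M (\<lambda>x. s n x - s m x) < e" for n e m0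
  proof -
    have "(\<integral>\<^sup>+x. ennreal ((cmod (s n x - \<phi> x))\<^sup>2) \<partial>M)
       = (\<integral>\<^sup>+x. liminf (\<lambda>k. ennreal ((cmod (s n x - s (r k) x))\<^sup>2)) \<partial>M)"
    proof (rule nn_integral_cong_AE)
      show "AE x in M. ennreal ((cmod (s n x - \<phi> x))\<^sup>2) = liminf (\<lambda>k. ennreal ((cmod (s n x - s (r k) x))\<^sup>2))"
        using limit
      proof eventually_elim
        case (elim x)
        then have "(\<lambda>k. ennreal ((cmod (s n x - s (r k) x))\<^sup>2)) \<longlonglongrightarrow> ennreal ((cmod (s n x - \<phi> x))\<^sup>2)"
          by (intro tendsto_intros)
        from lim_imp_Liminf[OF sequentially_bot this] show ?case by (rule sym)
      qed
    qed
    also have "\<dots> \<le> liminf (\<lambda>k. \<integral>\<^sup>+x. ennreal ((cmod (s n x - s (r k) x))\<^sup>2) \<partial>M)"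
      by (rule nn_integral_liminf) measurable
    also have "\<dots> \<le> limsup (\<lambda>k. \<integral>\<^sup>+x. ennreal ((cmod (s n x - s (r k) x))\<^sup>2) \<partial>M)"
      by (rule Liminf_le_Limsup) simp
    also have "\<dots> \<le> ennreal (e\<^sup>2)"
    proof (rule Limsup_bounded)
      have "(\<integral>\<^sup>+x. ennreal ((cmod (s n x - s (r k) x))\<^sup>2) \<partial>M) \<le> ennreal (e\<^sup>2)" if "m0 \<le> k" for k
      proof -
        have "m0 \<le> r k" using that by (simp add: r_def)
        then show ?thesis
          unfolding nn_integral_L2_norm[OF d]
          using n[of "r k"] L2_norm_nonneg by (intro ennreal_leI power_mono) (auto intro: less_imp_le)
      qed
      then show "\<forall>\<^sub>F k in sequentially. (\<integral>\<^sup>+x. ennreal ((cmod (s n x - s (r k) x))\<^sup>2) \<partial>M) \<le> ennreal (e\<^sup>2)"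
        by (auto simp: eventually_sequentially)
    qed
    finally show ?thesis .
  qed
  \<comment> \<open>Square integrability is shown first for \<open>s n - \<phi>\<close>, where Fatou
    gives a finite bound; that of \<phi> follows by subtraction.\<close>
  have diff_L2: "(\<lambda>x. s n x - \<phi> x) \<in> L2 M \<and> L2_norm M (\<lambda>x. s n x - \<phi> x) \<le> e"
    if "0 < e" "\<And>m. m0 \<le> m \<Longrightarrow> L2_norm M (\<lambda>x. s n x - s m x) < e" for n e m0
  proof -
    have F: "(\<integral>\<^sup>+x. ennreal ((cmod (s n x - \<phi> x))\<^sup>2) \<partial>M) \<le> ennreal (e\<^sup>2)" by (rule Fatou[OF that])
    have "ennreal (e\<^sup>2) < \<infinity>" by simp
    with F have fin: "(\<integral>\<^sup>+x. ennreal ((cmod (s n x - \<phi> x))\<^sup>2) \<partial>M) < \<infinity>"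
      by (rule le_less_trans)
    have m1: "(\<lambda>x. s n x - \<phi> x) \<in> borel_measurable M" by measurable
    have m2: "(\<lambda>x. (cmod (s n x - \<phi> x))\<^sup>2) \<in> borel_measurable M" by measurable
    have "integrable M (\<lambda>x. (cmod (s n x - \<phi> x))\<^sup>2)"
      by (rule integrableI_nonneg[OF m2 AE_I2 fin]) (rule zero_le_power2)
    with m1 have L: "(\<lambda>x. s n x - \<phi> x) \<in> L2 M" unfolding L2_def by blast
    have "(L2_norm M (\<lambda>x. s n x - \<phi> x))\<^sup>2 \<le> e\<^sup>2"
      using F unfolding nn_integral_L2_norm[OF L] by (simp add: ennreal_le_iff)
    then have "L2_norm M (\<lambda>x. s n x - \<phi> x) \<le> e" using that(1) by (rule power2_le_imp_le[OF _ less_imp_le])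
    with L show ?thesis by blast
  qed
  show ?thesis
  proof (rule that[of \<phi>])
    obtain m0 where "\<forall>m\<ge>m0. \<forall>n\<ge>m0. L2_norm M (\<lambda>x. s m x - s n x) < 1" using Cauchy[of 1] by auto
    then have "(\<lambda>x. s m0 x - \<phi> x) \<in> L2 M" using diff_L2[of 1 m0 m0] by simp
    from L2.diff_mem[OF s[of m0] this] show "\<phi> \<in> L2 M" by simp
    show "L2_tendsto M s \<phi>"
      unfolding L2_tendsto_def
    proof (rule LIMSEQ_I)
      fix e :: real assume e: "0 < e"
      then obtain m0 where m0: "\<forall>m\<ge>m0. \<forall>n\<ge>m0. L2_norm M (\<lambda>x. s m x - s n x) < e / 2" using Cauchy[of "e/2"] by auto
      have "L2_norm M (\<lambda>x. s n x - \<phi> x) \<le> e / 2" if "m0 \<le> n" for n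
        using diff_L2[of "e/2" m0 n] m0 that e by simp
      then have "norm (L2_norm M (\<lambda>x. s n x - \<phi> x) - 0) < e" if "m0 \<le> n" for n
        using that e L2_norm_nonneg[of M "\<lambda>x. s n x - \<phi> x"] by fastforce
      then show "\<exists>no. \<forall>n\<ge>no. norm (L2_norm M (\<lambda>x. s n x - \<phi> x) - 0) < e" by blast
    qed
  qed
qed

section \<open>Closures of sectorial forms\<close>

locale form_in_L2 = sectorial_form D a K
  for M :: "'x measure" and D :: "('x \<Rightarrow> complex) set" and a :: "'x form" and K :: real +
  assumes D_L2: "D \<subseteq> L2 M"
begin

lemma L2_mem: "u \<in> D \<Longrightarrow> u \<in> L2 M"
  using D_L2 by blast

text \<open>The form norm is the seminorm of the form shifted by the inner product. The shift adds a
  nonnegative real number on the diagonal, so the same \<open>K\<close> serves.\<close>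

sublocale norm: sectorial_form D "\<lambda>u v. a u v + L2_inner M u v" K
  using K_nonneg
  by unfold_locales
    (auto simp: add_mem scale_mem add_left add_right scale_left scale_right L2_mem
      L2.add_left L2.add_right L2.scale_left L2.scale_right distrib_left Re_nonneg Im_le
      L2_inner_self intro!: add_nonneg_nonneg order_trans[OF Im_le])

lemma form_norm_eq: "form_norm M a u = norm.form_seminorm u"
  by (simp add: form_norm_def L2_norm_sq)

lemmas form_norm_dist_triangle = norm.seminorm_dist_triangle[folded form_norm_eq]
  and form_norm_minus_commute = norm.seminorm_minus_commute[folded form_norm_eq]
  and form_norm_triangle_diff = norm.seminorm_triangle_diff[folded form_norm_eq]
  and form_norm_triangle = norm.seminorm_triangle[folded form_norm_eq]

lemma form_norm_nonneg: "u \<in> D \<Longrightarrow> 0 \<le> form_norm M a u"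
  by (simp add: form_norm_def Re_nonneg)

lemma L2_norm_le_form_norm: "u \<in> D \<Longrightarrow> L2_norm M u \<le> form_norm M a u"
  by (simp add: form_norm_def Re_nonneg real_le_rsqrt)

lemma seminorm_le_form_norm: "u \<in> D \<Longrightarrow> form_seminorm u \<le> form_norm M a u"
  by (simp add: form_norm_def)

lemma abs_le_form_norm:
  assumes "u \<in> D" "v \<in> D"
  shows "cmod (a u v) \<le> 2 * (1 + K) * (form_norm M a u * form_norm M a v)"
proof -
  have "form_seminorm u * form_seminorm v \<le> form_norm M a u * form_norm M a v"
    using assms by (intro mult_mono seminorm_le_form_norm) (auto simp: form_norm_nonneg Re_nonneg)
  then have "2 * (1 + K) * (form_seminorm u * form_seminorm v) \<le> 2 * (1 + K) * (form_norm M a u * form_norm M a v)"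
    using K_nonneg by (intro mult_left_mono) auto
  with abs_le[OF assms] show ?thesis by linarith
qed

lemma form_approxD:
  assumes "form_approx M D a s u"
  shows "s n \<in> D" "0 < e \<Longrightarrow> \<exists>N. \<forall>m\<ge>N. \<forall>n\<ge>N. form_norm M a (\<lambda>x. s m x - s n x) < e" "L2_tendsto M s u"
  using assms by (auto simp: form_approx_def form_Cauchy_def)

lemma form_approx_const: "u \<in> D \<Longrightarrow> form_approx M D a (\<lambda>_. u) u"
proof -
  assume "u \<in> D"
  \<comment> \<open>The difference of equal terms is the zero function, written as
    \<open>0 * u\<close> so that linearity yields the value 0.\<close>
  then have "(\<lambda>x. 0 * u x) \<in> D" "a (\<lambda>x. 0 * u x) (\<lambda>x. 0 * u x) = 0 * a u (\<lambda>x. 0 * u x)"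
    by (intro scale_mem scale_left; simp)+
  then show ?thesis
    using \<open>u \<in> D\<close> by (auto simp: form_approx_def form_Cauchy_def form_norm_def L2_tendsto_def L2_norm_def)
qed

lemma form_approx_diff:
  assumes s: "form_approx M D a s u" and t: "form_approx M D a t v" and uv: "u \<in> L2 M" "v \<in> L2 M"
  shows "form_approx M D a (\<lambda>n x. s n x - t n x) (\<lambda>x. u x - v x)"
  unfolding form_approx_def form_Cauchy_def
proof (intro conjI allI impI)
  note D = form_approxD(1)[OF s] form_approxD(1)[OF t]
  show "(\<lambda>x. s n x - t n x) \<in> D" for n using D by (intro diff_mem)
  show "\<exists>N. \<forall>m\<ge>N. \<forall>n\<ge>N. form_norm M a (\<lambda>x. s m x - t m x - (s n x - t n x)) < e" if e: "0 < e" for e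
  proof -
    obtain N1 where N1: "\<And>m n. m \<ge> N1 \<Longrightarrow> n \<ge> N1 \<Longrightarrow> form_norm M a (\<lambda>x. s m x - s n x) < e / 2"
      using form_approxD(2)[OF s, of "e/2"] e by auto
    obtain N2 where N2: "\<And>m n. m \<ge> N2 \<Longrightarrow> n \<ge> N2 \<Longrightarrow> form_norm M a (\<lambda>x. t m x - t n x) < e / 2"
      using form_approxD(2)[OF t, of "e/2"] e by auto
    have "form_norm M a (\<lambda>x. s m x - t m x - (s n x - t n x)) < e" if "m \<ge> max N1 N2" "n \<ge> max N1 N2" for m n
    proof -
      have "(\<lambda>x. s m x - t m x - (s n x - t n x)) = (\<lambda>x. (s m x - s n x) + (t n x - t m x))" by auto
      then have "form_norm M a (\<lambda>x. s m x - t m x - (s n x - t n x))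
          \<le> form_norm M a (\<lambda>x. s m x - s n x) + form_norm M a (\<lambda>x. t n x - t m x)"
        using form_norm_triangle[OF diff_mem[OF D(1) D(1)] diff_mem[OF D(2) D(2)], of m n n m] by (simp only:)
      then show ?thesis using N1[of m n] N2[of n m] that by simp
    qed
    then show ?thesis by blast
  qed
  have L: "(\<lambda>x. s n x - u x) \<in> L2 M" "(\<lambda>x. v x - t n x) \<in> L2 M" for n
    by (rule L2.diff_mem[OF L2_mem[OF D(1)] uv(1)], rule L2.diff_mem[OF uv(2) L2_mem[OF D(2)]])
  have "L2_norm M (\<lambda>x. s n x - t n x - (u x - v x)) \<le> L2_norm M (\<lambda>x. s n x - u x) + L2_norm M (\<lambda>x. t n x - v x)" for n
  proof -
    have "(\<lambda>x. s n x - t n x - (u x - v x)) = (\<lambda>x. (s n x - u x) + (v x - t n x))" by auto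
    then show ?thesis
      using L2_norm_triangle[OF L, of n n] L2_norm_minus_commute[OF uv(2) L2_mem[OF D(2)], of n] by (simp only:)
  qed
  then have le: "\<forall>\<^sub>F n in sequentially. norm (L2_norm M (\<lambda>x. s n x - t n x - (u x - v x)))
      \<le> L2_norm M (\<lambda>x. s n x - u x) + L2_norm M (\<lambda>x. t n x - v x)"
    by (intro always_eventually allI) (simp only: real_norm_def abs_of_nonneg[OF L2_norm_nonneg])
  show "L2_tendsto M (\<lambda>n x. s n x - t n x) (\<lambda>x. u x - v x)"
    unfolding L2_tendsto_def
    by (rule Lim_null_comparison[OF le tendsto_add_zero])
       (rule form_approxD(3)[OF s, unfolded L2_tendsto_def] form_approxD(3)[OF t, unfolded L2_tendsto_def])+
qed

lemma form_approx_bounded: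
  assumes s: "form_approx M D a s u"
  shows "\<exists>B>0. \<forall>n. form_norm M a (s n) \<le> B"
proof -
  note D = form_approxD(1)[OF s]
  obtain N where N: "\<And>m n. m \<ge> N \<Longrightarrow> n \<ge> N \<Longrightarrow> form_norm M a (\<lambda>x. s m x - s n x) < 1"
    using form_approxD(2)[OF s, of 1] by auto
  let ?B = "1 + form_norm M a (s N) + (\<Sum>n\<le>N. form_norm M a (s n))"
  have sum_nn: "0 \<le> (\<Sum>n\<le>N. form_norm M a (s n))" by (intro sum_nonneg form_norm_nonneg D)
  have "form_norm M a (s n) \<le> ?B" for n
  proof (cases "n \<le> N")
    case True
    then have "form_norm M a (s n) \<le> (\<Sum>n\<le>N. form_norm M a (s n))"
      by (intro member_le_sum) (auto simp: form_norm_nonneg D)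
    then show ?thesis using form_norm_nonneg[OF D, of N] by linarith
  next
    case False
    then have "form_norm M a (s n) - form_norm M a (s N) < 1"
      using form_norm_triangle_diff[OF D D, of n N] N[of n N] by linarith
    then show ?thesis using sum_nn by linarith
  qed
  moreover have "0 < ?B" using sum_nn form_norm_nonneg[OF D, of N] by linarith
  ultimately show ?thesis by blast
qed

lemma form_diff_le:
  assumes "u \<in> D" "v \<in> D" "u' \<in> D" "v' \<in> D" "form_norm M a u' \<le> B" "form_norm M a v \<le> B"
  shows "cmod (a u v - a u' v')
    \<le> 2 * (1 + K) * B * (form_norm M a (\<lambda>x. u x - u' x) + form_norm M a (\<lambda>x. v x - v' x))"
proof -
  let ?p = "form_norm M a (\<lambda>x. u x - u' x)" and ?q = "form_norm M a (\<lambda>x. v x - v' x)"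
  have nn: "0 \<le> ?p" "0 \<le> ?q" using assms by (auto intro!: form_norm_nonneg diff_mem)
  have "a u v - a u' v' = a (\<lambda>x. u x - u' x) v + a u' (\<lambda>x. v x - v' x)"
    using assms by (simp add: diff_left diff_right)
  then have "cmod (a u v - a u' v') \<le> cmod (a (\<lambda>x. u x - u' x) v) + cmod (a u' (\<lambda>x. v x - v' x))"
    by (simp add: norm_triangle_ineq)
  also have "\<dots> \<le> 2 * (1 + K) * (?p * form_norm M a v) + 2 * (1 + K) * (form_norm M a u' * ?q)"
    using assms by (intro add_mono abs_le_form_norm diff_mem)
  also have "\<dots> \<le> 2 * (1 + K) * (?p * B) + 2 * (1 + K) * (B * ?q)"
    using assms K_nonneg nn by (intro add_mono mult_left_mono mult_right_mono) auto
  finally show ?thesis by (simp add: algebra_simps)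
qed

lemma form_approx_convergent:
  assumes s: "form_approx M D a s u" and t: "form_approx M D a t v"
  shows "convergent (\<lambda>n. a (s n) (t n))"
proof -
  note D = form_approxD(1)[OF s] form_approxD(1)[OF t]
  obtain B1 where B1: "0 < B1" "\<And>n. form_norm M a (s n) \<le> B1" using form_approx_bounded[OF s] by blast
  obtain B2 where B2: "0 < B2" "\<And>n. form_norm M a (t n) \<le> B2" using form_approx_bounded[OF t] by blast
  define C where "C = 2 * (1 + K) * max B1 B2"
  have "0 < C" using K_nonneg B1 by (simp add: C_def less_max_iff_disj)
  have le: "cmod (a (s m) (t m) - a (s n) (t n))
     \<le> C * (form_norm M a (\<lambda>x. s m x - s n x) + form_norm M a (\<lambda>x. t m x - t n x))" for m n
    unfolding C_def using D B1(2)[of n] B2(2)[of m] by (intro form_diff_le) (auto intro: max.coboundedI1 max.coboundedI2)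
  have "Cauchy (\<lambda>n. a (s n) (t n))"
  proof (rule metric_CauchyI)
    fix e :: real assume "0 < e"
    then have e: "0 < e / (2 * C)" using \<open>0 < C\<close> by simp
    obtain N1 where N1: "\<And>m n. m \<ge> N1 \<Longrightarrow> n \<ge> N1 \<Longrightarrow> form_norm M a (\<lambda>x. s m x - s n x) < e / (2 * C)"
      using form_approxD(2)[OF s e] by auto
    obtain N2 where N2: "\<And>m n. m \<ge> N2 \<Longrightarrow> n \<ge> N2 \<Longrightarrow> form_norm M a (\<lambda>x. t m x - t n x) < e / (2 * C)"
      using form_approxD(2)[OF t e] by auto
    have "dist (a (s m) (t m)) (a (s n) (t n)) < e" if "m \<ge> max N1 N2" "n \<ge> max N1 N2" for m n
    proof -
      have "form_norm M a (\<lambda>x. s m x - s n x) + form_norm M a (\<lambda>x. t m x - t n x) < e / (2 * C) + e / (2 * C)"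
        using N1[of m n] N2[of m n] that by (intro add_strict_mono) auto
      also have "\<dots> = e / C" by simp
      finally have "C * (form_norm M a (\<lambda>x. s m x - s n x) + form_norm M a (\<lambda>x. t m x - t n x)) < e"
        using \<open>0 < C\<close> by (simp add: field_simps)
      then show ?thesis using le[of m n] by (simp add: dist_norm)
    qed
    then show "\<exists>N. \<forall>m\<ge>N. \<forall>n\<ge>N. dist (a (s m) (t m)) (a (s n) (t n)) < e" by blast
  qed
  then show ?thesis by (rule Cauchy_convergent)
qed

end

section \<open>Closable forms and convergence in the norm of the closure\<close>

locale closable_form = form_in_L2 +
  assumes closable: "form_closable M D a"
begin

text \<open>The difference of two sequences approximating one function is Cauchy and tends to 0 in
  L2, so closability sends its seminorm to 0. Existence of the limits comes from the Cauchy
  property; their independence of the sequences comes from here.\<close>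

lemma form_approx_unique_limit:
  assumes s: "form_approx M D a s u" "form_approx M D a s' u"
    and t: "form_approx M D a t v" "form_approx M D a t' v" and uv: "u \<in> L2 M" "v \<in> L2 M"
  shows "(\<lambda>n. a (s n) (t n) - a (s' n) (t' n)) \<longlonglongrightarrow> 0"
proof -
  have null: "(\<lambda>n. form_seminorm (\<lambda>x. p n x - p' n x)) \<longlonglongrightarrow> 0"
    if p: "form_approx M D a p w" "form_approx M D a p' w" and w: "w \<in> L2 M" for p p' w
  proof -
    have "form_approx M D a (\<lambda>n x. p n x - p' n x) (\<lambda>x. 0)"
      using form_approx_diff[OF p w w] by (simp only: diff_self)
    then have "(\<lambda>n. a (\<lambda>x. p n x - p' n x) (\<lambda>x. p n x - p' n x)) \<longlonglongrightarrow> 0"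
      unfolding form_approx_def
      by (rule closable[unfolded form_closable_def, rule_format, of "\<lambda>n x. p n x - p' n x"])
    from tendsto_real_sqrt[OF tendsto_Re[OF this]] show ?thesis by (simp only: zero_complex.sel real_sqrt_zero)
  qed
  note D = form_approxD(1)[OF s(1)] form_approxD(1)[OF s(2)] form_approxD(1)[OF t(1)] form_approxD(1)[OF t(2)]
  obtain B1 where B1: "0 < B1" "\<And>n. form_norm M a (s' n) \<le> B1" using form_approx_bounded[OF s(2)] by blast
  obtain B2 where B2: "0 < B2" "\<And>n. form_norm M a (t n) \<le> B2" using form_approx_bounded[OF t(1)] by blast
  let ?R = "\<lambda>n. 2 * (1 + K) * (form_seminorm (\<lambda>x. s n x - s' n x) * B2)
      + 2 * (1 + K) * (B1 * form_seminorm (\<lambda>x. t n x - t' n x))"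
  have "cmod (a (s n) (t n) - a (s' n) (t' n)) \<le> ?R n" for n
  proof -
    have "a (s n) (t n) - a (s' n) (t' n) = a (\<lambda>x. s n x - s' n x) (t n) + a (s' n) (\<lambda>x. t n x - t' n x)"
      using D by (simp add: diff_left diff_right)
    then have "cmod (a (s n) (t n) - a (s' n) (t' n)) \<le> cmod (a (\<lambda>x. s n x - s' n x) (t n)) + cmod (a (s' n) (\<lambda>x. t n x - t' n x))"
      by (simp add: norm_triangle_ineq)
    also have "\<dots> \<le> 2 * (1 + K) * (form_seminorm (\<lambda>x. s n x - s' n x) * form_seminorm (t n))
        + 2 * (1 + K) * (form_seminorm (s' n) * form_seminorm (\<lambda>x. t n x - t' n x))"
      by (intro add_mono abs_le diff_mem D)
    also have "\<dots> \<le> ?R n"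
      using K_nonneg D Re_nonneg[OF diff_mem[OF D(1) D(2)], of n n] Re_nonneg[OF diff_mem[OF D(3) D(4)], of n n]
        order_trans[OF seminorm_le_form_norm[OF D(3)] B2(2)[of n]] order_trans[OF seminorm_le_form_norm[OF D(2)] B1(2)[of n]]
      by (intro add_mono mult_left_mono mult_right_mono) simp_all
    finally show ?thesis .
  qed
  then have le: "\<forall>\<^sub>F n in sequentially. cmod (a (s n) (t n) - a (s' n) (t' n)) \<le> ?R n"
    by (intro always_eventually allI)
  have "?R \<longlonglongrightarrow> 2 * (1 + K) * (0 * B2) + 2 * (1 + K) * (B1 * 0)"
    by (intro tendsto_intros null[OF s uv(1)] null[OF t uv(2)])
  then have "?R \<longlonglongrightarrow> 0" by simp
  with le show ?thesis by (rule Lim_null_comparison)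
qed

lemma closure_form_tendsto:
  assumes s: "form_approx M D a s u" and t: "form_approx M D a t v" and uv: "u \<in> L2 M" "v \<in> L2 M"
  shows "(\<lambda>n. a (s n) (t n)) \<longlonglongrightarrow> closure_form M D a u v"
proof -
  obtain z where z: "(\<lambda>n. a (s n) (t n)) \<longlonglongrightarrow> z"
    using form_approx_convergent[OF s t] by (auto simp: convergent_def)
  have "closure_form M D a u v = z"
    unfolding closure_form_def
  proof (rule the_equality)
    show "\<exists>s t. form_approx M D a s u \<and> form_approx M D a t v \<and> (\<lambda>n. a (s n) (t n)) \<longlonglongrightarrow> z"
      using s t z by blast
    fix z' assume "\<exists>s t. form_approx M D a s u \<and> form_approx M D a t v \<and> (\<lambda>n. a (s n) (t n)) \<longlonglongrightarrow> z'"
    then obtain s' t' where s': "form_approx M D a s' u" "form_approx M D a t' v" "(\<lambda>n. a (s' n) (t' n)) \<longlonglongrightarrow> z'"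
      by blast
    have "z' - z = 0"
      by (rule LIMSEQ_unique[OF tendsto_diff[OF s'(3) z] form_approx_unique_limit[OF s'(1) s s'(2) t uv]])
    then show "z' = z" by simp
  qed
  with z show ?thesis by simp
qed

text \<open>Inequalities for the norm of the closure are obtained as limits of inequalities on
  \<open>D\<close>; this limit is the bridge. The function \<open>w - u\<close> is approximated with
  \<open>w\<close> as a constant sequence.\<close>

lemma closure_form_norm_tendsto:
  assumes r: "form_approx M D a r u" and u: "u \<in> L2 M" and w: "w \<in> D"
  shows "(\<lambda>m. form_norm M a (\<lambda>x. w x - r m x)) \<longlonglongrightarrow> form_norm M (closure_form M D a) (\<lambda>x. w x - u x)"
proof -
  have wu: "(\<lambda>x. w x - u x) \<in> L2 M" by (rule L2.diff_mem[OF L2_mem[OF w] u])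
  have A: "form_approx M D a (\<lambda>m x. w x - r m x) (\<lambda>x. w x - u x)"
    using form_approx_diff[OF form_approx_const[OF w] r L2_mem[OF w] u] .
  have 1: "(\<lambda>m. a (\<lambda>x. w x - r m x) (\<lambda>x. w x - r m x)) \<longlonglongrightarrow> closure_form M D a (\<lambda>x. w x - u x) (\<lambda>x. w x - u x)"
    by (rule closure_form_tendsto[OF A A wu wu])
  have 2: "(\<lambda>m. L2_norm M (\<lambda>x. w x - r m x)) \<longlonglongrightarrow> L2_norm M (\<lambda>x. w x - u x)"
  proof (rule Lim_null[THEN iffD2], rule Lim_null_comparison)
    show "\<forall>\<^sub>F m in sequentially. norm (L2_norm M (\<lambda>x. w x - r m x) - L2_norm M (\<lambda>x. w x - u x))
       \<le> L2_norm M (\<lambda>x. (w x - r m x) - (w x - u x))"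
      using L2_norm_triangle_diff[OF L2_mem[OF form_approxD(1)[OF A]] wu] by (intro always_eventually allI) simp
    show "(\<lambda>m. L2_norm M (\<lambda>x. (w x - r m x) - (w x - u x))) \<longlonglongrightarrow> 0"
      using form_approxD(3)[OF A] by (simp add: L2_tendsto_def)
  qed
  show ?thesis unfolding form_norm_def by (intro tendsto_intros 1 2)
qed

text \<open>Traces are defined by convergence in the norm of the closure, its domain by Cauchy
  sequences; this lemma and the next translate between the two.\<close>

lemma form_approx_imp_form_tendsto:
  assumes s: "form_approx M D a s u" and u: "u \<in> L2 M"
  shows "form_tendsto M (closure_form M D a) s u"
  unfolding form_tendsto_def
proof (rule LIMSEQ_I)
  note D = form_approxD(1)[OF s]
  fix e :: real assume "0 < e"
  then obtain N where N: "\<And>m n. m \<ge> N \<Longrightarrow> n \<ge> N \<Longrightarrow> form_norm M a (\<lambda>x. s m x - s n x) < e / 2"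
    using form_approxD(2)[OF s, of "e/2"] by auto
  have "norm (form_norm M (closure_form M D a) (\<lambda>x. s n x - u x) - 0) < e" if "n \<ge> N" for n
  proof -
    note lim = closure_form_norm_tendsto[OF s u D, of n]
    have "form_norm M (closure_form M D a) (\<lambda>x. s n x - u x) \<le> e / 2"
      by (rule LIMSEQ_le_const2[OF lim]) (use N[OF that] in \<open>auto intro!: exI[of _ N] less_imp_le\<close>)
    moreover have "0 \<le> form_norm M (closure_form M D a) (\<lambda>x. s n x - u x)"
      by (rule LIMSEQ_le_const[OF lim]) (auto simp: form_norm_nonneg diff_mem D)
    ultimately show ?thesis using \<open>0 < e\<close> by simp
  qed
  then show "\<exists>N. \<forall>n\<ge>N. norm (form_norm M (closure_form M D a) (\<lambda>x. s n x - u x) - 0) < e" by blast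
qed

lemma form_tendsto_imp_form_approx:
  assumes u: "u \<in> closure_dom M D a" and s: "\<And>n. s n \<in> D"
    and lim: "form_tendsto M (closure_form M D a) s u"
  shows "form_approx M D a s u"
proof -
  let ?N = "\<lambda>n. form_norm M (closure_form M D a) (\<lambda>x. s n x - u x)"
  obtain r where r: "form_approx M D a r u" and uL2: "u \<in> L2 M" using u by (auto simp: closure_dom_def)
  note rD = form_approxD(1)[OF r]
  note rlim = closure_form_norm_tendsto[OF r uL2 s]
  \<comment> \<open>The triangle inequality through the intermediate point \<open>r k\<close>, with
    \<open>k\<close> tending to infinity.\<close>
  have 1: "form_norm M a (\<lambda>x. s m x - s n x) \<le> ?N m + ?N n" for m n
  proof (rule LIMSEQ_le_const)
    show "(\<lambda>k. form_norm M a (\<lambda>x. s m x - r k x) + form_norm M a (\<lambda>x. s n x - r k x)) \<longlonglongrightarrow> ?N m + ?N n"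
      by (intro tendsto_add rlim)
    have "form_norm M a (\<lambda>x. s m x - s n x) \<le> form_norm M a (\<lambda>x. s m x - r k x) + form_norm M a (\<lambda>x. s n x - r k x)" for k
      using form_norm_dist_triangle[OF s[of m] rD[of k] s[of n]] form_norm_minus_commute[OF rD[of k] s[of n]] by linarith
    then show "\<exists>N. \<forall>k\<ge>N. form_norm M a (\<lambda>x. s m x - s n x)
        \<le> form_norm M a (\<lambda>x. s m x - r k x) + form_norm M a (\<lambda>x. s n x - r k x)" by blast
  qed
  \<comment> \<open>Again through \<open>r k\<close>: the norm of the closure dominates the L2
    norm.\<close>
  have "L2_norm M (\<lambda>x. s n x - u x) - 0 - ?N n \<le> 0" for n
  proof (rule LIMSEQ_le_const2)
    show "(\<lambda>k. L2_norm M (\<lambda>x. s n x - u x) - L2_norm M (\<lambda>x. r k x - u x) - form_norm M a (\<lambda>x. s n x - r k x))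
        \<longlonglongrightarrow> L2_norm M (\<lambda>x. s n x - u x) - 0 - ?N n"
      using form_approxD(3)[OF r] unfolding L2_tendsto_def by (intro tendsto_diff tendsto_const rlim)
    have "L2_norm M (\<lambda>x. s n x - u x) - L2_norm M (\<lambda>x. r k x - u x) - form_norm M a (\<lambda>x. s n x - r k x) \<le> 0" for k
      using L2_norm_dist_triangle[OF L2_mem[OF s[of n]] L2_mem[OF rD[of k]] uL2]
        L2_norm_le_form_norm[OF diff_mem[OF s[of n] rD[of k]]] by linarith
    then show "\<exists>N. \<forall>k\<ge>N. L2_norm M (\<lambda>x. s n x - u x) - L2_norm M (\<lambda>x. r k x - u x) - form_norm M a (\<lambda>x. s n x - r k x) \<le> 0"
      by blast
  qed
  then have 2: "L2_norm M (\<lambda>x. s n x - u x) \<le> ?N n" for n by simp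
  show ?thesis
    unfolding form_approx_def form_Cauchy_def
  proof (intro conjI allI impI s)
    fix e :: real assume "0 < e"
    then have "\<forall>\<^sub>F n in sequentially. ?N n < e / 2"
      using lim unfolding form_tendsto_def by (intro order_tendstoD(2)[of _ 0]) auto
    then obtain N where N: "\<And>n. n \<ge> N \<Longrightarrow> ?N n < e / 2" by (auto simp: eventually_sequentially)
    have "form_norm M a (\<lambda>x. s m x - s n x) < e" if "m \<ge> N" "n \<ge> N" for m n
      using 1[of m n] N[OF that(1)] N[OF that(2)] by linarith
    then show "\<exists>N. \<forall>m\<ge>N. \<forall>n\<ge>N. form_norm M a (\<lambda>x. s m x - s n x) < e" by blast
  next
    show "L2_tendsto M s u"
      unfolding L2_tendsto_def
      by (rule real_tendsto_sandwich[OF _ _ tendsto_const lim[unfolded form_tendsto_def]])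
         (auto simp: L2_norm_nonneg 2)
  qed
qed

end

section \<open>The Neumann form\<close>

lemma L2_inner_tendsto:
  assumes "\<And>n. s n \<in> L2 M" "u \<in> L2 M" "v \<in> L2 M" "L2_tendsto M s u"
  shows "(\<lambda>n. L2_inner M (s n) v) \<longlonglongrightarrow> L2_inner M u v"
proof (rule Lim_null[THEN iffD2], rule Lim_null_comparison)
  have "norm (L2_inner M (s n) v - L2_inner M u v) \<le> 2 * (L2_norm M (\<lambda>x. s n x - u x) * L2_norm M v)" for n
    using L2_inner_le[OF L2.diff_mem[OF assms(1,2)] assms(3), of n] assms by (simp add: L2.diff_left)
  then show "\<forall>\<^sub>F n in sequentially. norm (L2_inner M (s n) v - L2_inner M u v) \<le> 2 * (L2_norm M (\<lambda>x. s n x - u x) * L2_norm M v)"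
    by (intro always_eventually allI)
  have "(\<lambda>n. 2 * (L2_norm M (\<lambda>x. s n x - u x) * L2_norm M v)) \<longlonglongrightarrow> 2 * (0 * L2_norm M v)"
    using assms(4) unfolding L2_tendsto_def by (intro tendsto_intros)
  then show "(\<lambda>n. 2 * (L2_norm M (\<lambda>x. s n x - u x) * L2_norm M v)) \<longlonglongrightarrow> 0" by simp
qed

lemma L2_norm_tendsto:
  assumes "\<And>n. s n \<in> L2 M" "u \<in> L2 M" "L2_tendsto M s u"
  shows "(\<lambda>n. L2_norm M (s n)) \<longlonglongrightarrow> L2_norm M u"
proof (rule Lim_null[THEN iffD2], rule Lim_null_comparison)
  show "\<forall>\<^sub>F n in sequentially. norm (L2_norm M (s n) - L2_norm M u) \<le> L2_norm M (\<lambda>x. s n x - u x)"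
    using L2_norm_triangle_diff[OF assms(1,2)] by (intro always_eventually allI) simp
qed (use assms(3) in \<open>simp add: L2_tendsto_def\<close>)

lemma L2_inner_cong_AE:
  assumes "AE x in M. f x = g x" "f \<in> L2 M" "g \<in> L2 M" "v \<in> L2 M"
  shows "L2_inner M f v = L2_inner M g v"
  unfolding L2_inner_def
proof (rule integral_cong_AE)
  show "AE x in M. f x * cnj (v x) = g x * cnj (v x)" using assms(1) by eventually_elim simp
qed (rule borel_measurable_integrable[OF L2_inner_integrable[OF assms(2,4)]]
    borel_measurable_integrable[OF L2_inner_integrable[OF assms(3,4)]])+

text \<open>A midpoint-convex functional below \<open>e\<close> on a tail stays below
  \<open>e\<close> on its hull. It is meant for the L2 distance to \<open>u\<close> and for the
  error of \<open>a(p, v)\<close> against \<open>(f, v)\<close>, the two limits that averaging must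
  preserve.\<close>

lemma (in sectorial_form) midhull_tendsto_0:
  fixes F :: "('x \<Rightarrow> complex) \<Rightarrow> real"
  assumes s: "\<And>n. s n \<in> D" and w: "\<And>n. w n \<in> midhull (s ` {n..})"
    and F_nonneg: "\<And>p. 0 \<le> F p"
    and F_mid: "\<And>p q. p \<in> D \<Longrightarrow> q \<in> D \<Longrightarrow> F (\<lambda>x. (p x + q x) / 2) \<le> (F p + F q) / 2"
    and lim: "(\<lambda>n. F (s n)) \<longlonglongrightarrow> 0"
  shows "(\<lambda>n. F (w n)) \<longlonglongrightarrow> 0"
proof (rule LIMSEQ_I)
  fix e :: real assume "0 < e"
  then obtain N where N: "\<And>n. n \<ge> N \<Longrightarrow> F (s n) < e"
    using LIMSEQ_D[OF lim, of e] F_nonneg by (auto simp: abs_of_nonneg)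
  have hull: "p \<in> D \<and> F p < e" if "p \<in> midhull (s ` {n..})" "N \<le> n" for p n
    using that(1)
  proof induction
    case (base p)
    then show ?case using N that(2) s by auto
  next
    case (mid p q)
    then show ?case using F_mid[of p q] mid_mem[of p q] by auto
  qed
  then have "norm (F (w n) - 0) < e" if "N \<le> n" for n
    using hull[OF w that] F_nonneg[of "w n"] by simp
  then show "\<exists>no. \<forall>n\<ge>no. norm (F (w n) - 0) < e" by blast
qed

section \<open>Sobolev functions and their weak derivatives\<close>

lemma H1_imp_L2: "u \<in> H1 \<Omega> \<Longrightarrow> u \<in> L2 (lebesgue_on \<Omega>)"
  by (simp add: H1_def)

lemma weak_partial_L2: "u \<in> H1 \<Omega> \<Longrightarrow> weak_partial \<Omega> i u \<in> L2 (lebesgue_on \<Omega>)"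
  and is_weak_partial_weak_partial: "u \<in> H1 \<Omega> \<Longrightarrow> is_weak_partial \<Omega> i u (weak_partial \<Omega> i u)"
proof -
  assume "u \<in> H1 \<Omega>"
  then have "\<exists>g. g \<in> L2 (lebesgue_on \<Omega>) \<and> is_weak_partial \<Omega> i u g" by (auto simp: H1_def)
  from someI_ex[OF this]
  show "weak_partial \<Omega> i u \<in> L2 (lebesgue_on \<Omega>)" "is_weak_partial \<Omega> i u (weak_partial \<Omega> i u)"
    by (auto simp: weak_partial_def)
qed

text \<open>\<open>weak_partial\<close> is an arbitrary choice, so it is linear only almost
  everywhere, and that is inferred from this uniqueness.\<close>

lemma is_weak_partial_unique:
  assumes "open \<Omega>" "g \<in> L2 (lebesgue_on \<Omega>)" "h \<in> L2 (lebesgue_on \<Omega>)"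
    and "is_weak_partial \<Omega> i u g" "is_weak_partial \<Omega> i u h"
  shows "AE x in lebesgue_on \<Omega>. g x = h x"
proof -
  have "AE x in lebesgue_on \<Omega>. g x - h x = 0"
  proof (rule weak_null_imp_AE_0[OF assms(1) L2.diff_mem[OF assms(2,3)]])
    fix v assume v: "v \<in> test_functions \<Omega>"
    have "(\<integral>x. g x * v x \<partial>lebesgue_on \<Omega>) = (\<integral>x. h x * v x \<partial>lebesgue_on \<Omega>)"
      using assms(4)[unfolded is_weak_partial_def, rule_format, OF v]
        assms(5)[unfolded is_weak_partial_def, rule_format, OF v] by (simp only: neg_equal_iff_equal)
    then show "(\<integral>x. (g x - h x) * v x \<partial>lebesgue_on \<Omega>) = 0"
      using L2_mult_integrable[OF assms(2) test_function_L2(1)[OF assms(1) v]]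
        L2_mult_integrable[OF assms(3) test_function_L2(1)[OF assms(1) v]]
      by (simp add: left_diff_distrib)
  qed
  then show ?thesis by simp
qed

lemma is_weak_partial_add:
  assumes "open \<Omega>" "u \<in> L2 (lebesgue_on \<Omega>)" "w \<in> L2 (lebesgue_on \<Omega>)" "g \<in> L2 (lebesgue_on \<Omega>)" "h \<in> L2 (lebesgue_on \<Omega>)"
    and "is_weak_partial \<Omega> i u g" "is_weak_partial \<Omega> i w h"
  shows "is_weak_partial \<Omega> i (\<lambda>x. u x + w x) (\<lambda>x. g x + h x)"
  unfolding is_weak_partial_def
proof
  fix v assume v: "v \<in> test_functions \<Omega>"
  note int = L2_mult_integrable[OF _ test_function_L2(1)[OF assms(1) v]] L2_mult_integrable[OF _ test_function_L2(2)[OF assms(1) v]]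
  show "(\<integral>x. (u x + w x) * pdiff i v x \<partial>lebesgue_on \<Omega>) = - (\<integral>x. (g x + h x) * v x \<partial>lebesgue_on \<Omega>)"
    unfolding distrib_right Bochner_Integration.integral_add[OF int(1)[OF assms(4)] int(1)[OF assms(5)]]
      Bochner_Integration.integral_add[OF int(2)[OF assms(2)] int(2)[OF assms(3)]]
      assms(6)[unfolded is_weak_partial_def, rule_format, OF v]
      assms(7)[unfolded is_weak_partial_def, rule_format, OF v] by (simp only: minus_add_distrib)
qed

lemma is_weak_partial_scale:
  "is_weak_partial \<Omega> i u g \<Longrightarrow> is_weak_partial \<Omega> i (\<lambda>x. z * u x) (\<lambda>x. z * g x)"
  unfolding is_weak_partial_def mult.assoc integral_mult_right_zero mult_minus_right[symmetric]
  by (intro ballI arg_cong[where f="(*) z"]) blast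

lemma H1_I:
  assumes "u \<in> L2 (lebesgue_on \<Omega>)"
    and "\<And>i. g i \<in> L2 (lebesgue_on \<Omega>)" "\<And>i. is_weak_partial \<Omega> i u (g i)"
  shows "u \<in> H1 \<Omega>"
  using assms unfolding H1_def by blast

lemma
  assumes \<Omega>: "open \<Omega>" and u: "u \<in> H1 \<Omega>" and w: "w \<in> H1 \<Omega>"
  shows H1_add: "(\<lambda>x. u x + w x) \<in> H1 \<Omega>"
    and weak_partial_add:
      "AE x in lebesgue_on \<Omega>. weak_partial \<Omega> i (\<lambda>x. u x + w x) x = weak_partial \<Omega> i u x + weak_partial \<Omega> i w x"
proof -
  let ?g = "\<lambda>i x. weak_partial \<Omega> i u x + weak_partial \<Omega> i w x"
  have g: "?g i \<in> L2 (lebesgue_on \<Omega>)" for i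
    by (rule L2_add[OF weak_partial_L2[OF u] weak_partial_L2[OF w]])
  have p: "is_weak_partial \<Omega> i (\<lambda>x. u x + w x) (?g i)" for i
    by (rule is_weak_partial_add[OF \<Omega> H1_imp_L2[OF u] H1_imp_L2[OF w] weak_partial_L2[OF u] weak_partial_L2[OF w]
          is_weak_partial_weak_partial[OF u] is_weak_partial_weak_partial[OF w]])
  show H: "(\<lambda>x. u x + w x) \<in> H1 \<Omega>"
    by (rule H1_I[OF L2_add[OF H1_imp_L2[OF u] H1_imp_L2[OF w]] g p])
  show "AE x in lebesgue_on \<Omega>. weak_partial \<Omega> i (\<lambda>x. u x + w x) x = ?g i x"
    by (rule is_weak_partial_unique[OF \<Omega> weak_partial_L2[OF H] g is_weak_partial_weak_partial[OF H] p])
qed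

lemma
  assumes \<Omega>: "open \<Omega>" and u: "u \<in> H1 \<Omega>"
  shows H1_scale: "(\<lambda>x. z * u x) \<in> H1 \<Omega>"
    and weak_partial_scale:
      "AE x in lebesgue_on \<Omega>. weak_partial \<Omega> i (\<lambda>x. z * u x) x = z * weak_partial \<Omega> i u x"
proof -
  let ?g = "\<lambda>i x. z * weak_partial \<Omega> i u x"
  have g: "?g i \<in> L2 (lebesgue_on \<Omega>)" for i
    by (rule L2_scale[OF weak_partial_L2[OF u]])
  have p: "is_weak_partial \<Omega> i (\<lambda>x. z * u x) (?g i)" for i
    by (rule is_weak_partial_scale[OF is_weak_partial_weak_partial[OF u]])
  show H: "(\<lambda>x. z * u x) \<in> H1 \<Omega>"
    by (rule H1_I[OF L2_scale[OF H1_imp_L2[OF u]] g p])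
  show "AE x in lebesgue_on \<Omega>. weak_partial \<Omega> i (\<lambda>x. z * u x) x = ?g i x"
    by (rule is_weak_partial_unique[OF \<Omega> weak_partial_L2[OF H] g is_weak_partial_weak_partial[OF H] p])
qed

section \<open>Bounded sectorial coefficients\<close>

lemma L2_mult_Linf:
  assumes "u \<in> L2 M" "c \<in> Linf M"
  shows "(\<lambda>x. u x * c x) \<in> L2 M"
proof -
  have [measurable]: "u \<in> borel_measurable M" "c \<in> borel_measurable M" using assms by (auto simp: L2_def Linf_def)
  obtain C where C: "AE x in M. cmod (c x) \<le> C" using assms by (auto simp: Linf_def)
  have "integrable M (\<lambda>x. (cmod (u x * c x))\<^sup>2)"
  proof (rule Bochner_Integration.integrable_bound)
    show "integrable M (\<lambda>x. C\<^sup>2 * (cmod (u x))\<^sup>2)" using assms by (simp add: L2_def)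
    show "AE x in M. norm ((cmod (u x * c x))\<^sup>2) \<le> norm (C\<^sup>2 * (cmod (u x))\<^sup>2)"
      using C
    proof eventually_elim
      case (elim x)
      then have "(cmod (c x))\<^sup>2 \<le> C\<^sup>2" by (intro power_mono) auto
      then have "(cmod (c x))\<^sup>2 * (cmod (u x))\<^sup>2 \<le> C\<^sup>2 * (cmod (u x))\<^sup>2" by (rule mult_right_mono) simp
      then show ?case by (simp add: norm_mult power_mult_distrib mult.commute)
    qed
  qed measurable
  then show ?thesis by (simp add: L2_def)
qed

text \<open>\<open>tan \<theta>\<close> is the slope of the bounding ray; \<theta> below
  \<open>pi / 2\<close> keeps the cosine positive and the tangent monotone.\<close>

lemma sector_bounds:
  assumes "z \<in> sector \<theta>" "0 \<le> \<theta>" "\<theta> < pi / 2"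
  shows "0 \<le> Re z" "\<bar>Im z\<bar> \<le> tan \<theta> * Re z"
proof -
  obtain r \<alpha> where z: "z = complex_of_real r * cis \<alpha>" "0 \<le> r" "\<bar>\<alpha>\<bar> \<le> \<theta>"
    using assms(1) by (auto simp: sector_def)
  have cos: "0 < cos \<alpha>" using z(3) assms by (intro cos_gt_zero_pi) auto
  then show "0 \<le> Re z" using z by simp
  have "tan \<bar>\<alpha>\<bar> \<le> tan \<theta>" using z(3) assms by (intro tan_mono_le) auto
  moreover have "\<bar>sin \<alpha>\<bar> = tan \<bar>\<alpha>\<bar> * cos \<alpha>"
  proof -
    have "0 \<le> sin \<bar>\<alpha>\<bar>" using z(3) assms by (intro sin_ge_zero) auto
    then have "\<bar>sin \<alpha>\<bar> = sin \<bar>\<alpha>\<bar>" by (auto simp: abs_if split: if_splits)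
    moreover have "cos \<bar>\<alpha>\<bar> = cos \<alpha>" by (simp add: abs_if)
    ultimately show ?thesis using cos by (simp add: tan_def)
  qed
  ultimately have "\<bar>sin \<alpha>\<bar> \<le> tan \<theta> * cos \<alpha>" using cos by (simp add: mult_right_mono)
  then have "r * \<bar>sin \<alpha>\<bar> \<le> r * (tan \<theta> * cos \<alpha>)" using z(2) by (rule mult_left_mono)
  then show "\<bar>Im z\<bar> \<le> tan \<theta> * Re z" using z by (simp add: abs_mult mult.left_commute)
qed

text \<open>The vector will be the weak gradient at \<open>x\<close>, which varies with the point,
  whereas the null set in the hypothesis depends on the vector. Countably many dense vectors share
  one null set; off it the two inequalities, being closed conditions on the vector, extend to all
  vectors.\<close>

lemma sectorial_AE_uniform:
  fixes c :: "'n::finite \<Rightarrow> 'n \<Rightarrow> 'x \<Rightarrow> complex"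
  assumes \<theta>: "0 \<le> \<theta>" "\<theta> < pi / 2"
    and sect: "\<And>\<xi> :: complex ^ 'n. AE x in M. (\<Sum>i\<in>UNIV. \<Sum>j\<in>UNIV. c i j x * \<xi> $ i * cnj (\<xi> $ j)) \<in> sector \<theta>"
  shows "AE x in M. \<forall>\<xi> :: complex ^ 'n. let z = (\<Sum>i\<in>UNIV. \<Sum>j\<in>UNIV. c i j x * \<xi> $ i * cnj (\<xi> $ j))
      in 0 \<le> Re z \<and> \<bar>Im z\<bar> \<le> tan \<theta> * Re z"
proof -
  obtain S :: "(complex ^ 'n) set" where S: "countable S" "\<And>X. open X \<Longrightarrow> X \<noteq> {} \<Longrightarrow> \<exists>d\<in>S. d \<in> X"
    using countable_dense_exists by blast
  have "AE x in M. \<forall>\<xi>\<in>S. (\<Sum>i\<in>UNIV. \<Sum>j\<in>UNIV. c i j x * \<xi> $ i * cnj (\<xi> $ j)) \<in> sector \<theta>"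
    using sect by (simp add: AE_ball_countable[OF S(1)])
  then show ?thesis
  proof eventually_elim
    case (elim x)
    let ?Q = "\<lambda>\<xi> :: complex ^ 'n. (\<Sum>i\<in>UNIV. \<Sum>j\<in>UNIV. c i j x * \<xi> $ i * cnj (\<xi> $ j))"
    let ?C = "{\<xi>. 0 \<le> Re (?Q \<xi>)} \<inter> {\<xi>. \<bar>Im (?Q \<xi>)\<bar> \<le> tan \<theta> * Re (?Q \<xi>)}"
    have "continuous_on UNIV ?Q" by (intro continuous_intros)
    then have "closed ?C" by (intro closed_Int closed_Collect_le continuous_intros)
    then have "open (- ?C)" by (rule open_Compl)
    moreover have "\<xi> \<in> ?C" if "\<xi> \<in> S" for \<xi>
    proof -
      have "?Q \<xi> \<in> sector \<theta>" using elim that by blast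
      from sector_bounds[OF this \<theta>] show ?thesis by blast
    qed
    ultimately have "- ?C = {}" using S(2)[of "- ?C"] by blast
    then show ?case unfolding Let_def by blast
  qed
qed

lemma neumann_closable_form:
  fixes \<Omega> :: "(real ^ 'n::finite) set"
  assumes \<Omega>: "open \<Omega>" and c: "\<And>i j. c i j \<in> Linf (lebesgue_on \<Omega>)"
    and \<theta>: "0 \<le> \<theta>" "\<theta> < pi / 2"
    and sect: "\<And>\<xi> :: complex ^ 'n. AE x in lebesgue_on \<Omega>.
           (\<Sum>i\<in>UNIV. \<Sum>j\<in>UNIV. c i j x * \<xi> $ i * cnj (\<xi> $ j)) \<in> sector \<theta>"
    and closable: "form_closable (lebesgue_on \<Omega>) (H1 \<Omega>) (neumann_form \<Omega> c)"
  shows "closable_form (lebesgue_on \<Omega>) (H1 \<Omega>) (neumann_form \<Omega> c) (tan \<theta>)"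
proof -
  let ?M = "lebesgue_on \<Omega>" and ?D = "weak_partial \<Omega>"
  have int: "integrable ?M (\<lambda>x. g x * c i j x * cnj (h x))" if "g \<in> L2 ?M" "h \<in> L2 ?M" for g h i j
    by (rule L2_inner_integrable[OF L2_mult_Linf[OF that(1) c] that(2)])
  \<comment> \<open>Since the chosen weak derivatives are linear only almost everywhere, this puts
    the pointwise linear expressions under the integral in their place.\<close>
  have cong: "(\<integral>x. g x * c i j x * cnj (h x) \<partial>?M) = (\<integral>x. g' x * c i j x * cnj (h' x) \<partial>?M)"
    if "AE x in ?M. g x = g' x" "AE x in ?M. h x = h' x" "g \<in> L2 ?M" "h \<in> L2 ?M" "g' \<in> L2 ?M" "h' \<in> L2 ?M" for g h g' h' i j
  proof (rule integral_cong_AE)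
    show "AE x in ?M. g x * c i j x * cnj (h x) = g' x * c i j x * cnj (h' x)"
      using that(1,2) by eventually_elim simp
  qed (rule borel_measurable_integrable[OF int[OF that(3,4)]] borel_measurable_integrable[OF int[OF that(5,6)]])+
  note L = weak_partial_L2
  show ?thesis
  proof (unfold_locales, goal_cases)
    case 1
    show ?case using \<theta> by (cases "\<theta> = 0") (auto intro!: less_imp_le tan_gt_zero)
  next
    case (2 u v)
    then show ?case by (rule H1_add[OF \<Omega>])
  next
    case (3 u z)
    then show ?case by (rule H1_scale[OF \<Omega>])
  next
    case (4 u v w)
    have "(\<integral>x. ?D i (\<lambda>x. u x + v x) x * c i j x * cnj (?D j w x) \<partial>?M)
      = (\<integral>x. ?D i u x * c i j x * cnj (?D j w x) \<partial>?M) + (\<integral>x. ?D i v x * c i j x * cnj (?D j w x) \<partial>?M)" for i j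
    proof -
      have "(\<integral>x. ?D i (\<lambda>x. u x + v x) x * c i j x * cnj (?D j w x) \<partial>?M)
        = (\<integral>x. (?D i u x + ?D i v x) * c i j x * cnj (?D j w x) \<partial>?M)"
        using 4 \<Omega> by (intro cong weak_partial_add L L2_add H1_add AE_I2 refl)
      then show ?thesis
        using int[OF L[OF 4(1)] L[OF 4(3)]] int[OF L[OF 4(2)] L[OF 4(3)]] by (simp add: distrib_right)
    qed
    then show ?case by (simp add: neumann_form_def sum.distrib)
  next
    case (5 u v w)
    have "(\<integral>x. ?D i w x * c i j x * cnj (?D j (\<lambda>x. u x + v x) x) \<partial>?M)
      = (\<integral>x. ?D i w x * c i j x * cnj (?D j u x) \<partial>?M) + (\<integral>x. ?D i w x * c i j x * cnj (?D j v x) \<partial>?M)" for i j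
    proof -
      have "(\<integral>x. ?D i w x * c i j x * cnj (?D j (\<lambda>x. u x + v x) x) \<partial>?M)
        = (\<integral>x. ?D i w x * c i j x * cnj (?D j u x + ?D j v x) \<partial>?M)"
        using 5 \<Omega> by (intro cong weak_partial_add L L2_add H1_add AE_I2 refl)
      then show ?thesis
        using int[OF L[OF 5(3)] L[OF 5(1)]] int[OF L[OF 5(3)] L[OF 5(2)]] by (simp add: distrib_left)
    qed
    then show ?case by (simp add: neumann_form_def sum.distrib)
  next
    case (6 u w z)
    have "(\<integral>x. ?D i (\<lambda>x. z * u x) x * c i j x * cnj (?D j w x) \<partial>?M)
      = z * (\<integral>x. ?D i u x * c i j x * cnj (?D j w x) \<partial>?M)" for i j
    proof -
      have "(\<integral>x. ?D i (\<lambda>x. z * u x) x * c i j x * cnj (?D j w x) \<partial>?M)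
        = (\<integral>x. (z * ?D i u x) * c i j x * cnj (?D j w x) \<partial>?M)"
        using 6 \<Omega> by (intro cong weak_partial_scale L L2_scale H1_scale AE_I2 refl)
      then show ?thesis by (simp add: mult.assoc)
    qed
    then show ?case by (simp add: neumann_form_def sum_distrib_left)
  next
    case (7 u w z)
    have "(\<integral>x. ?D i w x * c i j x * cnj (?D j (\<lambda>x. z * u x) x) \<partial>?M)
      = cnj z * (\<integral>x. ?D i w x * c i j x * cnj (?D j u x) \<partial>?M)" for i j
    proof -
      have "(\<integral>x. ?D i w x * c i j x * cnj (?D j (\<lambda>x. z * u x) x) \<partial>?M)
        = (\<integral>x. ?D i w x * c i j x * cnj (z * ?D j u x) \<partial>?M)"
        using 7 \<Omega> by (intro cong weak_partial_scale L L2_scale H1_scale AE_I2 refl)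
      also have "\<dots> = (\<integral>x. cnj z * (?D i w x * c i j x * cnj (?D j u x)) \<partial>?M)"
        by (simp add: mult_ac)
      finally show ?thesis by simp
    qed
    then show ?case by (simp add: neumann_form_def sum_distrib_left)
  next
    case (8 u)
    let ?Q = "\<lambda>x. \<Sum>i\<in>UNIV. \<Sum>j\<in>UNIV. ?D i u x * c i j x * cnj (?D j u x)"
    have intQ: "integrable ?M ?Q" by (intro Bochner_Integration.integrable_sum int L 8)
    have eq: "neumann_form \<Omega> c u u = (\<integral>x. ?Q x \<partial>?M)"
      unfolding neumann_form_def
      by (simp add: Bochner_Integration.integral_sum Bochner_Integration.integrable_sum int L[OF 8])
    have "AE x in ?M. 0 \<le> Re (?Q x)"
      using sectorial_AE_uniform[OF \<theta> sect]
    proof eventually_elim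
      case (elim x)
      from elim[rule_format, of "\<chi> i. ?D i u x"] show ?case by (simp add: Let_def mult_ac)
    qed
    then show ?case unfolding eq by (subst integral_Re[OF intQ, symmetric]) (rule integral_nonneg_AE)
  next
    case (9 u)
    let ?Q = "\<lambda>x. \<Sum>i\<in>UNIV. \<Sum>j\<in>UNIV. ?D i u x * c i j x * cnj (?D j u x)"
    have intQ: "integrable ?M ?Q" by (intro Bochner_Integration.integrable_sum int L 9)
    have eq: "neumann_form \<Omega> c u u = (\<integral>x. ?Q x \<partial>?M)"
      unfolding neumann_form_def
      by (simp add: Bochner_Integration.integral_sum Bochner_Integration.integrable_sum int L[OF 9])
    have "AE x in ?M. \<bar>Im (?Q x)\<bar> \<le> tan \<theta> * Re (?Q x)"
      using sectorial_AE_uniform[OF \<theta> sect]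
    proof eventually_elim
      case (elim x)
      from elim[rule_format, of "\<chi> i. ?D i u x"] show ?case by (simp add: Let_def mult_ac)
    qed
    then have "(\<integral>x. \<bar>Im (?Q x)\<bar> \<partial>?M) \<le> (\<integral>x. tan \<theta> * Re (?Q x) \<partial>?M)"
      using intQ by (intro integral_mono_AE integrable_abs integrable_Im integrable_mult_right integrable_Re)
    also have "\<dots> = tan \<theta> * Re (neumann_form \<Omega> c u u)"
      unfolding eq integral_Re[OF intQ, symmetric] by simp
    finally show ?case
      unfolding eq integral_Im[OF intQ, symmetric]
      using integral_abs_bound[of ?M "\<lambda>x. Im (?Q x)"] by linarith
  next
    case 10
    show ?case by (auto simp: H1_def)
  next
    case 11
    show ?case by (rule closable)
  qed
qed

lemma L2_inner_cnj: "cnj (L2_inner M u v) = L2_inner M v u"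
  unfolding L2_inner_def Bochner_Integration.integral_cnj[symmetric] by (simp add: mult.commute)

text \<open>This pins down the choice made in \<open>weak_op\<close>, so that the conormal condition
  can be read with \<open>f\<close> itself.\<close>

lemma weakly_eq_unique:
  assumes "open \<Omega>" "weakly_eq \<Omega> c u f" "weakly_eq \<Omega> c u g"
  shows "AE x in lebesgue_on \<Omega>. f x = g x"
proof -
  have f: "f \<in> L2 (lebesgue_on \<Omega>)" and g: "g \<in> L2 (lebesgue_on \<Omega>)"
    using assms(2,3) by (auto simp: weakly_eq_def)
  have "AE x in lebesgue_on \<Omega>. f x - g x = 0"
  proof (rule weak_null_imp_AE_0[OF assms(1) L2.diff_mem[OF f g]])
    fix v assume v: "v \<in> test_functions \<Omega>" and real: "\<And>x. cnj (v x) = v x"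
    note vL2 = test_function_L2(1)[OF assms(1) v]
    have "(\<integral>x. f x * cnj (v x) \<partial>lebesgue_on \<Omega>) = (\<integral>x. g x * cnj (v x) \<partial>lebesgue_on \<Omega>)"
      using assms(2,3) v unfolding weakly_eq_def by simp
    then have "(\<integral>x. f x * v x \<partial>lebesgue_on \<Omega>) = (\<integral>x. g x * v x \<partial>lebesgue_on \<Omega>)"
      by (simp only: real)
    then show "(\<integral>x. (f x - g x) * v x \<partial>lebesgue_on \<Omega>) = 0"
      unfolding left_diff_distrib
        Bochner_Integration.integral_diff[OF L2_mult_integrable[OF f vL2] L2_mult_integrable[OF g vL2]]
      by simp
  qed
  then show ?thesis by simp
qed

section \<open>The form with boundary measure\<close>

locale neumann_boundary =
  fixes \<Omega> :: "(real ^ 'n::finite) set"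
    and c :: "'n \<Rightarrow> 'n \<Rightarrow> real ^ 'n \<Rightarrow> complex"
    and \<theta> :: real
    and \<mu> :: "(real ^ 'n) measure"
  assumes \<Omega>: "open \<Omega>"
    and sets_\<mu>: "sets \<mu> = sets (restrict_space borel (frontier \<Omega>))"
    and neumann: "closable_form (lebesgue_on \<Omega>) (H1 \<Omega>) (neumann_form \<Omega> c) (tan \<theta>)"
begin

sublocale N: closable_form "lebesgue_on \<Omega>" "H1 \<Omega>" "neumann_form \<Omega> c" "tan \<theta>"
  by (rule neumann)

lemma bdry_dom_H1: "u \<in> bdry_dom \<Omega> \<mu> \<Longrightarrow> u \<in> H1 \<Omega>"
  by (simp add: bdry_dom_def)

text \<open>Measurability comes from continuity up to the closure, as \<mu> lives on the Borel sets
  of the frontier.\<close>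

lemma bdry_dom_L2: "u \<in> bdry_dom \<Omega> \<mu> \<Longrightarrow> u \<in> L2 \<mu>"
proof -
  assume u: "u \<in> bdry_dom \<Omega> \<mu>"
  then have "continuous_on (frontier \<Omega>) u"
    using continuous_on_subset[of "closure \<Omega>" u "frontier \<Omega>"] by (auto simp: bdry_dom_def frontier_def)
  then have "u \<in> borel_measurable (restrict_space borel (frontier \<Omega>))"
    by (rule borel_measurable_continuous_on_restrict)
  then have m: "u \<in> borel_measurable \<mu>"
    by (simp only: measurable_cong_sets[OF sets_\<mu> refl])
  then have "(\<lambda>x. (cmod (u x))\<^sup>2) \<in> borel_measurable \<mu>" by measurable
  then have "integrable \<mu> (\<lambda>x. (cmod (u x))\<^sup>2)"
    by (rule integrableI_nonneg) (use u in \<open>auto simp: bdry_dom_def\<close>)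
  with m show ?thesis by (simp add: L2_def)
qed

lemma bdry_dom_iff:
  "u \<in> bdry_dom \<Omega> \<mu> \<longleftrightarrow> u \<in> H1 \<Omega> \<and> continuous_on (closure \<Omega>) u \<and> u \<in> L2 \<mu>"
proof -
  have "(\<integral>\<^sup>+x. ennreal ((cmod (u x))\<^sup>2) \<partial>\<mu>) < \<infinity>" if "u \<in> L2 \<mu>"
    unfolding nn_integral_L2_norm[OF that] by simp
  then show ?thesis using bdry_dom_L2[of u] by (auto simp: bdry_dom_def)
qed

lemma bdry_form_eq: "bdry_form \<Omega> \<mu> c u v = neumann_form \<Omega> c u v + L2_inner \<mu> u v"
  by (simp add: bdry_form_def L2_inner_def)

text \<open>An instance of \<open>form_in_L2\<close> and not of \<open>closable_form\<close>, since
  \<open>a\<close> may fail to be closable. The boundary term is real and nonnegative on the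
  diagonal and so keeps the constant \<open>tan \<theta>\<close>.\<close>

sublocale B: form_in_L2 "lebesgue_on \<Omega>" "bdry_dom \<Omega> \<mu>" "bdry_form \<Omega> \<mu> c" "tan \<theta>"
proof (unfold_locales, goal_cases)
  case 1
  show ?case by (rule N.K_nonneg)
next
  case (2 u v)
  then show ?case unfolding bdry_dom_iff by (intro conjI H1_add[OF \<Omega>] L2_add continuous_intros) auto
next
  case (3 u z)
  then show ?case unfolding bdry_dom_iff by (intro conjI H1_scale[OF \<Omega>] L2_scale continuous_intros) auto
next
  case (4 u v w)
  note H = 4[THEN bdry_dom_H1] and L = 4[THEN bdry_dom_L2]
  show ?case unfolding bdry_form_eq N.add_left[OF H] L2.add_left[OF L] by simp
next
  case (5 u v w)
  note H = 5[THEN bdry_dom_H1] and L = 5[THEN bdry_dom_L2]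
  show ?case unfolding bdry_form_eq N.add_right[OF H] L2.add_right[OF L] by simp
next
  case (6 u w z)
  note H = 6[THEN bdry_dom_H1] and L = 6[THEN bdry_dom_L2]
  show ?case unfolding bdry_form_eq N.scale_left[OF H] L2.scale_left[OF L] by (simp add: distrib_left)
next
  case (7 u w z)
  note H = 7[THEN bdry_dom_H1] and L = 7[THEN bdry_dom_L2]
  show ?case unfolding bdry_form_eq N.scale_right[OF H] L2.scale_right[OF L] by (simp add: distrib_left)
next
  case (8 u)
  show ?case unfolding bdry_form_eq
    using N.Re_nonneg[OF bdry_dom_H1[OF 8]] L2.Re_nonneg[OF bdry_dom_L2[OF 8]] by simp
next
  case (9 u)
  have "0 \<le> tan \<theta> * Re (L2_inner \<mu> u u)"
    using N.K_nonneg L2.Re_nonneg[OF bdry_dom_L2[OF 9]] by simp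
  moreover have "Im (L2_inner \<mu> u u) = 0" by (simp add: L2_inner_self)
  ultimately show ?case unfolding bdry_form_eq
    using N.Im_le[OF bdry_dom_H1[OF 9]] by (simp add: distrib_left)
next
  case 10
  show ?case using bdry_dom_H1 H1_imp_L2 by blast
qed

lemma test_function_frontier:
  assumes v: "v \<in> test_functions \<Omega>" and x: "x \<in> space \<mu>"
  shows "v x = 0"
proof -
  have "space \<mu> = frontier \<Omega>"
    using sets_eq_imp_space_eq[OF sets_\<mu>] by (simp add: space_restrict_space)
  then have "x \<notin> \<Omega>" using x \<Omega> by (auto simp: frontier_def interior_open)
  then show ?thesis by (rule test_functionD(3)[OF v])
qed

lemma test_functions_subset_bdry_dom:
  assumes v: "v \<in> test_functions \<Omega>"
  shows "v \<in> bdry_dom \<Omega> \<mu>"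
proof -
  have "(\<integral>\<^sup>+x. ennreal ((cmod (v x))\<^sup>2) \<partial>\<mu>) = (\<integral>\<^sup>+x. 0 \<partial>\<mu>)"
    by (intro nn_integral_cong) (simp add: test_function_frontier[OF v])
  then show ?thesis
    using v test_functions_subset_H1[OF \<Omega>] continuous_on_subset[OF test_function_continuous[OF v] subset_UNIV]
    by (auto simp: bdry_dom_def)
qed

text \<open>The squared norm of \<open>a\<close> is a sum of three nonnegative terms: Neumann
  energy, boundary mass and L2 mass on \<Omega>. A Cauchy sequence for \<open>a\<close> is therefore
  Cauchy both for the Neumann form and in L2 of \<mu>.\<close>

lemma form_norm_bdry:
  assumes "u \<in> bdry_dom \<Omega> \<mu>"
  shows "form_norm (lebesgue_on \<Omega>) (neumann_form \<Omega> c) u \<le> B.norm.form_seminorm u"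
    and "L2_norm \<mu> u \<le> B.norm.form_seminorm u"
proof -
  have "Re (bdry_form \<Omega> \<mu> c u u + L2_inner (lebesgue_on \<Omega>) u u)
      = Re (neumann_form \<Omega> c u u) + (L2_norm \<mu> u)\<^sup>2 + (L2_norm (lebesgue_on \<Omega>) u)\<^sup>2"
    by (simp add: bdry_form_eq L2_norm_sq)
  moreover have "0 \<le> Re (neumann_form \<Omega> c u u)" by (rule N.Re_nonneg[OF bdry_dom_H1[OF assms]])
  ultimately show "form_norm (lebesgue_on \<Omega>) (neumann_form \<Omega> c) u \<le> B.norm.form_seminorm u"
    and "L2_norm \<mu> u \<le> B.norm.form_seminorm u"
    by (auto simp: form_norm_def intro!: real_le_rsqrt)
qed

text \<open>Common to both directions of the equivalence: interior and boundary parts converge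
  separately. The closure of the Neumann form appears by treating \<open>v\<close> as a constant
  approximation of itself.\<close>

lemma bdry_form_tendsto:
  assumes s: "\<And>n. s n \<in> bdry_dom \<Omega> \<mu>" and u: "u \<in> L2 (lebesgue_on \<Omega>)"
    and appr: "form_approx (lebesgue_on \<Omega>) (H1 \<Omega>) (neumann_form \<Omega> c) s u"
    and \<phi>: "\<phi> \<in> L2 \<mu>" "L2_tendsto \<mu> s \<phi>" and v: "v \<in> bdry_dom \<Omega> \<mu>"
  shows "(\<lambda>n. bdry_form \<Omega> \<mu> c (s n) v) \<longlonglongrightarrow> neumann_closure \<Omega> c u v + L2_inner \<mu> \<phi> v"
  unfolding bdry_form_eq neumann_closure_def
  by (intro tendsto_add
      N.closure_form_tendsto[OF appr N.form_approx_const[OF bdry_dom_H1[OF v]] u H1_imp_L2[OF bdry_dom_H1[OF v]]]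
      L2_inner_tendsto[OF bdry_dom_L2[OF s] \<phi>(1) bdry_dom_L2[OF v] \<phi>(2)])

section \<open>The associated operator and traces\<close>

lemma assoc_op_imp_trace:
  assumes u: "u \<in> L2 (lebesgue_on \<Omega>)" and A: "(u, f) \<in> assoc_op (lebesgue_on \<Omega>) (bdry_dom \<Omega> \<mu>) (bdry_form \<Omega> \<mu> c)"
  obtains \<phi> where "\<phi> \<in> L2 \<mu>" "is_trace \<Omega> \<mu> c u \<phi>"
    and "\<And>v. v \<in> bdry_dom \<Omega> \<mu> \<Longrightarrow> neumann_closure \<Omega> c u v + L2_inner \<mu> \<phi> v = L2_inner (lebesgue_on \<Omega>) f v"
proof -
  let ?M = "lebesgue_on \<Omega>" and ?D = "bdry_dom \<Omega> \<mu>" and ?a = "bdry_form \<Omega> \<mu> c"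
  obtain s where s: "\<And>n. s n \<in> ?D" and bnd: "bounded (range (\<lambda>n. Re (?a (s n) (s n))))"
    and su: "L2_tendsto ?M s u" and sf: "\<And>v. v \<in> ?D \<Longrightarrow> (\<lambda>n. ?a (s n) v) \<longlonglongrightarrow> L2_inner ?M f v"
    using A unfolding assoc_op_def by blast
  obtain B1 where B1: "\<And>n. Re (?a (s n) (s n)) \<le> B1"
    using bnd by (auto simp: bounded_iff dest: abs_le_D1)
  \<comment> \<open>The definition of the operator bounds the real part of \<open>a\<close> alone;
    the L2 part of the form norm is bounded because \<open>s\<close> converges.\<close>
  have "Bseq (\<lambda>n. L2_norm ?M (s n))"
    using L2_norm_tendsto[OF B.L2_mem[OF s] u su] by (intro convergent_imp_Bseq) (auto simp: convergent_def)
  then obtain B2 where B2: "\<And>n. L2_norm ?M (s n) \<le> B2"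
    by (auto simp: Bseq_def dest: abs_le_D1)
  have sB: "Re (?a (s n) (s n) + L2_inner ?M (s n) (s n)) \<le> B1 + B2\<^sup>2" for n
    using B1[of n] power_mono[OF B2 L2_norm_nonneg, of n 2] by (simp add: L2_norm_sq)
  \<comment> \<open>Averaging takes place for the form shifted by the inner product, so the
    resulting Cauchy property covers Neumann energy, boundary norm and L2 norm at once.\<close>
  obtain w where w: "\<And>n. w n \<in> midhull (s ` {n..})"
    and wC: "\<And>e. 0 < e \<Longrightarrow> \<exists>N. \<forall>m\<ge>N. \<forall>n\<ge>N. B.norm.form_seminorm (\<lambda>x. w m x - w n x) < e"
    by (rule B.norm.bounded_imp_midhull_Cauchy[of s, OF s sB]) blast
  have wD: "w n \<in> ?D" for n
    using s by (intro B.midhull_mem[OF w]) blast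
  have wdiff: "(\<lambda>x. w m x - w n x) \<in> ?D" for m n by (rule B.diff_mem[OF wD wD])
  have "(\<lambda>n. L2_norm ?M (\<lambda>x. w n x - u x)) \<longlonglongrightarrow> 0"
  proof (rule B.midhull_tendsto_0[where F="\<lambda>p. L2_norm ?M (\<lambda>x. p x - u x)", OF s w L2_norm_nonneg])
    fix p q assume "p \<in> ?D" "q \<in> ?D"
    then have p: "(\<lambda>x. p x - u x) \<in> L2 ?M" and q: "(\<lambda>x. q x - u x) \<in> L2 ?M"
      using L2.diff_mem[OF B.L2_mem u] by blast+
    have "(\<lambda>x. (p x + q x) / 2 - u x) = (\<lambda>x. ((p x - u x) + (q x - u x)) / 2)" by (auto simp: field_simps)
    then have eq: "L2_norm ?M (\<lambda>x. (p x + q x) / 2 - u x) = L2_norm ?M (\<lambda>x. (p x - u x) + (q x - u x)) / 2"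
      using L2_norm_half[OF L2_add[OF p q]] by (simp only:)
    show "L2_norm ?M (\<lambda>x. (p x + q x) / 2 - u x) \<le> (L2_norm ?M (\<lambda>x. p x - u x) + L2_norm ?M (\<lambda>x. q x - u x)) / 2"
      unfolding eq by (rule divide_right_mono[OF L2_norm_triangle[OF p q]]) simp
  qed (use su in \<open>simp add: L2_tendsto_def\<close>)
  then have wu: "L2_tendsto ?M w u" by (simp add: L2_tendsto_def)
  \<comment> \<open>The error is the modulus of an affine function of \<open>p\<close>, hence
    midpoint convex, so the averages inherit the limit.\<close>
  have wf: "(\<lambda>n. ?a (w n) v) \<longlonglongrightarrow> L2_inner ?M f v" if v: "v \<in> ?D" for v
  proof -
    have "(\<lambda>n. cmod (?a (w n) v - L2_inner ?M f v)) \<longlonglongrightarrow> 0"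
    proof (rule B.midhull_tendsto_0[where F="\<lambda>p. cmod (?a p v - L2_inner ?M f v)", OF s w norm_ge_zero])
      fix p q assume pq: "p \<in> ?D" "q \<in> ?D"
      have "?a (\<lambda>x. (p x + q x) / 2) v - L2_inner ?M f v
          = ((?a p v - L2_inner ?M f v) + (?a q v - L2_inner ?M f v)) / 2"
        by (simp add: B.mid_left[OF pq v] field_simps)
      then have eq: "cmod (?a (\<lambda>x. (p x + q x) / 2) v - L2_inner ?M f v)
          = cmod ((?a p v - L2_inner ?M f v) + (?a q v - L2_inner ?M f v)) / 2"
        by (simp only: norm_divide norm_numeral)
      show "cmod (?a (\<lambda>x. (p x + q x) / 2) v - L2_inner ?M f v)
          \<le> (cmod (?a p v - L2_inner ?M f v) + cmod (?a q v - L2_inner ?M f v)) / 2"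
        unfolding eq by (rule divide_right_mono[OF norm_triangle_ineq]) simp
    qed (rule tendsto_norm_zero[OF Lim_null[THEN iffD1, OF sf[OF v]]])
    then show ?thesis by (rule Lim_null[THEN iffD2, OF tendsto_norm_zero_cancel])
  qed
  have appr: "form_approx ?M (H1 \<Omega>) (neumann_form \<Omega> c) w u"
    unfolding form_approx_def form_Cauchy_def
  proof (intro conjI allI impI wu bdry_dom_H1 wD)
    fix e :: real assume "0 < e"
    from wC[OF this] show "\<exists>N. \<forall>m\<ge>N. \<forall>n\<ge>N. form_norm ?M (neumann_form \<Omega> c) (\<lambda>x. w m x - w n x) < e"
      using le_less_trans[OF form_norm_bdry(1)[OF wdiff]] by blast
  qed
  have \<mu>C: "\<exists>N. \<forall>m\<ge>N. \<forall>n\<ge>N. L2_norm \<mu> (\<lambda>x. w m x - w n x) < e" if "0 < e" for e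
    using wC[OF that] le_less_trans[OF form_norm_bdry(2)[OF wdiff]] by blast
  obtain \<phi> where \<phi>: "\<phi> \<in> L2 \<mu>" "L2_tendsto \<mu> w \<phi>"
    by (rule L2_complete[of w, OF bdry_dom_L2[OF wD] \<mu>C]) blast
  have "u \<in> neumann_closure_dom \<Omega> c"
    unfolding neumann_closure_dom_def closure_dom_def using u appr by blast
  moreover have "form_tendsto ?M (neumann_closure \<Omega> c) w u"
    unfolding neumann_closure_def by (rule N.form_approx_imp_form_tendsto[OF appr u])
  ultimately have "is_trace \<Omega> \<mu> c u \<phi>"
    unfolding is_trace_def using \<phi> wD by blast
  moreover have "neumann_closure \<Omega> c u v + L2_inner \<mu> \<phi> v = L2_inner ?M f v" if "v \<in> ?D" for v
    by (rule LIMSEQ_unique[OF bdry_form_tendsto[OF wD u appr \<phi> that] wf[OF that]])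
  ultimately show ?thesis using that \<phi>(1) by blast
qed

lemma trace_imp_assoc_op:
  assumes u: "u \<in> L2 (lebesgue_on \<Omega>)" and f: "f \<in> L2 (lebesgue_on \<Omega>)" and tr: "is_trace \<Omega> \<mu> c u \<phi>"
    and eq: "\<And>v. v \<in> bdry_dom \<Omega> \<mu> \<Longrightarrow> neumann_closure \<Omega> c u v + L2_inner \<mu> \<phi> v = L2_inner (lebesgue_on \<Omega>) f v"
  shows "(u, f) \<in> assoc_op (lebesgue_on \<Omega>) (bdry_dom \<Omega> \<mu>) (bdry_form \<Omega> \<mu> c)"
proof -
  let ?M = "lebesgue_on \<Omega>" and ?D = "bdry_dom \<Omega> \<mu>" and ?a = "bdry_form \<Omega> \<mu> c"
  obtain s where dom: "u \<in> neumann_closure_dom \<Omega> c" and \<phi>: "\<phi> \<in> L2 \<mu>" "L2_tendsto \<mu> s \<phi>"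
    and s: "\<And>n. s n \<in> ?D" and su: "form_tendsto ?M (neumann_closure \<Omega> c) s u"
    using tr unfolding is_trace_def by blast
  have appr: "form_approx ?M (H1 \<Omega>) (neumann_form \<Omega> c) s u"
    by (rule N.form_tendsto_imp_form_approx[OF dom[unfolded neumann_closure_dom_def] bdry_dom_H1[OF s]
          su[unfolded neumann_closure_def]])
  have lim: "(\<lambda>n. ?a (s n) v) \<longlonglongrightarrow> L2_inner ?M f v" if "v \<in> ?D" for v
    using bdry_form_tendsto[OF s u appr \<phi> that] by (simp only: eq[OF that])
  \<comment> \<open>Both parts of \<open>Re a\<close> on the diagonal converge along
    \<open>s\<close>, which yields the boundedness that the operator demands.\<close>
  have "convergent (\<lambda>n. neumann_form \<Omega> c (s n) (s n))" by (rule N.form_approx_convergent[OF appr appr])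
  then obtain z where z: "(\<lambda>n. neumann_form \<Omega> c (s n) (s n)) \<longlonglongrightarrow> z" by (auto simp: convergent_def)
  have "(\<lambda>n. Re (neumann_form \<Omega> c (s n) (s n)) + (L2_norm \<mu> (s n))\<^sup>2) \<longlonglongrightarrow> Re z + (L2_norm \<mu> \<phi>)\<^sup>2"
    by (intro tendsto_add tendsto_Re z tendsto_power L2_norm_tendsto[OF bdry_dom_L2[OF s] \<phi>])
  then have "convergent (\<lambda>n. Re (?a (s n) (s n)))"
    unfolding bdry_form_eq plus_complex.sel L2_norm_sq[symmetric] by (rule convergentI)
  then have "bounded (range (\<lambda>n. Re (?a (s n) (s n))))"
    by (intro Bseq_eq_bounded[THEN iffD1] convergent_imp_Bseq)
  then show ?thesis
    using u f s lim N.form_approxD(3)[OF appr] unfolding assoc_op_def by blast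
qed

lemma trace_unique:
  assumes tr: "is_trace \<Omega> \<mu> c u \<phi>" "is_trace \<Omega> \<mu> c u \<psi>"
    and cn: "weak_conormal \<Omega> \<mu> c u \<phi>" "weak_conormal \<Omega> \<mu> c u \<psi>"
  shows "AE x in \<mu>. \<phi> x = \<psi> x"
proof -
  obtain s where \<phi>: "\<phi> \<in> L2 \<mu>" and s: "\<And>n. s n \<in> bdry_dom \<Omega> \<mu>" "L2_tendsto \<mu> s \<phi>"
    using tr(1) unfolding is_trace_def by blast
  obtain t where \<psi>: "\<psi> \<in> L2 \<mu>" and t: "\<And>n. t n \<in> bdry_dom \<Omega> \<mu>" "L2_tendsto \<mu> t \<psi>"
    using tr(2) unfolding is_trace_def by blast
  let ?d = "\<lambda>x. \<phi> x - \<psi> x"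
  have d: "?d \<in> L2 \<mu>" by (rule L2.diff_mem[OF \<phi> \<psi>])
  have orth: "L2_inner \<mu> ?d v = 0" if v: "v \<in> bdry_dom \<Omega> \<mu>" for v
  proof -
    have "- L2_inner \<mu> \<phi> v = - L2_inner \<mu> \<psi> v"
      using cn v unfolding weak_conormal_def L2_inner_def by metis
    then show ?thesis using L2.diff_left[OF \<phi> \<psi> bdry_dom_L2[OF v]] by simp
  qed
  have "L2_inner \<mu> ?d \<phi> = 0"
  proof (rule LIMSEQ_unique)
    \<comment> \<open>Limits are available in the first argument of the inner product; conjugation
      moves them to the second.\<close>
    show "(\<lambda>n. cnj (L2_inner \<mu> (s n) ?d)) \<longlonglongrightarrow> L2_inner \<mu> ?d \<phi>"
      using tendsto_cnj[OF L2_inner_tendsto[OF bdry_dom_L2[OF s(1)] \<phi> d s(2)]] by (simp only: L2_inner_cnj)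
    show "(\<lambda>n. cnj (L2_inner \<mu> (s n) ?d)) \<longlonglongrightarrow> 0"
      by (simp only: L2_inner_cnj orth[OF s(1)] tendsto_const)
  qed
  moreover have "L2_inner \<mu> ?d \<psi> = 0"
  proof (rule LIMSEQ_unique)
    show "(\<lambda>n. cnj (L2_inner \<mu> (t n) ?d)) \<longlonglongrightarrow> L2_inner \<mu> ?d \<psi>"
      using tendsto_cnj[OF L2_inner_tendsto[OF bdry_dom_L2[OF t(1)] \<psi> d t(2)]] by (simp only: L2_inner_cnj)
    show "(\<lambda>n. cnj (L2_inner \<mu> (t n) ?d)) \<longlonglongrightarrow> 0"
      by (simp only: L2_inner_cnj orth[OF t(1)] tendsto_const)
  qed
  ultimately have "L2_inner \<mu> ?d ?d = 0" using L2.diff_right[OF \<phi> \<psi> d] by simp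
  then have "L2_norm \<mu> ?d = 0" by (simp add: L2_norm_eq)
  from L2_norm_eq_0_imp_AE[OF d this] show ?thesis by eventually_elim simp
qed

text \<open>\<open>weak_op\<close> agrees with \<open>f\<close> almost everywhere, so both give the
  same integrals. The condition becomes the identity that links the operator to its traces in both
  directions.\<close>

lemma conormal_iff:
  assumes "weakly_eq \<Omega> c u f"
  shows "weak_conormal \<Omega> \<mu> c u \<phi> \<longleftrightarrow>
    (\<forall>v\<in>bdry_dom \<Omega> \<mu>. neumann_closure \<Omega> c u v + L2_inner \<mu> \<phi> v = L2_inner (lebesgue_on \<Omega>) f v)"
proof -
  have w: "weakly_eq \<Omega> c u (weak_op \<Omega> c u)"
    unfolding weak_op_def by (rule someI[of "weakly_eq \<Omega> c u", OF assms])
  have "AE x in lebesgue_on \<Omega>. weak_op \<Omega> c u x = f x" by (rule weakly_eq_unique[OF \<Omega> w assms])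
  moreover have "weak_op \<Omega> c u \<in> L2 (lebesgue_on \<Omega>)" and "f \<in> L2 (lebesgue_on \<Omega>)"
    using w assms by (auto simp: weakly_eq_def)
  ultimately have "L2_inner (lebesgue_on \<Omega>) (weak_op \<Omega> c u) v = L2_inner (lebesgue_on \<Omega>) f v" if "v \<in> bdry_dom \<Omega> \<mu>" for v
    by (rule L2_inner_cong_AE[OF _ _ _ B.L2_mem[OF that]])
  moreover have "x - y = - z \<longleftrightarrow> x + z = y" for x y z :: complex
    by (auto simp: algebra_simps)
  ultimately show ?thesis
    unfolding weak_conormal_def L2_inner_def[symmetric] by simp
qed

lemma weakly_eqI:
  assumes "is_trace \<Omega> \<mu> c u \<phi>" "f \<in> L2 (lebesgue_on \<Omega>)"
    and eq: "\<And>v. v \<in> bdry_dom \<Omega> \<mu> \<Longrightarrow> neumann_closure \<Omega> c u v + L2_inner \<mu> \<phi> v = L2_inner (lebesgue_on \<Omega>) f v"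
  shows "weakly_eq \<Omega> c u f"
proof -
  have "neumann_closure \<Omega> c u v = L2_inner (lebesgue_on \<Omega>) f v" if v: "v \<in> test_functions \<Omega>" for v
  proof -
    have "L2_inner \<mu> \<phi> v = (\<integral>x. 0 \<partial>\<mu>)"
      unfolding L2_inner_def
      by (rule Bochner_Integration.integral_cong[OF refl]) (simp add: test_function_frontier[OF v])
    then show ?thesis using eq[OF test_functions_subset_bdry_dom[OF v]] by simp
  qed
  then show ?thesis
    using assms(1,2) by (simp add: weakly_eq_def is_trace_def L2_inner_def)
qed

end

theorem proposition4p13:
  fixes \<Omega> :: "(real ^ 'n::finite) set"
    and c :: "'n \<Rightarrow> 'n \<Rightarrow> real ^ 'n \<Rightarrow> complex"
    and \<theta> :: real
    and \<mu> :: "(real ^ 'n) measure"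
    and u f :: "real ^ 'n \<Rightarrow> complex"
  assumes "open \<Omega>"
    and "\<And>i j. c i j \<in> Linf (lebesgue_on \<Omega>)"
    and "0 \<le> \<theta>" and "\<theta> < pi / 2"
    and "\<And>\<xi> :: complex ^ 'n. AE x in lebesgue_on \<Omega>.
           (\<Sum>i\<in>UNIV. \<Sum>j\<in>UNIV. c i j x * \<xi> $ i * cnj (\<xi> $ j)) \<in> sector \<theta>"
    and "sets \<mu> = sets (restrict_space borel (frontier \<Omega>))"
    and "\<And>K. compact K \<Longrightarrow> K \<subseteq> frontier \<Omega> \<Longrightarrow> emeasure \<mu> K < \<infinity>"
    and "form_closable (lebesgue_on \<Omega>) (H1 \<Omega>) (neumann_form \<Omega> c)"
    and "u \<in> L2 (lebesgue_on \<Omega>)" and "f \<in> L2 (lebesgue_on \<Omega>)"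
  shows "((u, f) \<in> assoc_op (lebesgue_on \<Omega>) (bdry_dom \<Omega> \<mu>) (bdry_form \<Omega> \<mu> c)
           \<longleftrightarrow> u \<in> H1_trace \<Omega> \<mu> c \<and> weakly_eq \<Omega> c u f
              \<and> (\<exists>\<phi> \<in> L2 \<mu>. is_trace \<Omega> \<mu> c u \<phi> \<and> weak_conormal \<Omega> \<mu> c u \<phi>))
       \<and> (u \<in> H1_trace \<Omega> \<mu> c \<and> weakly_eq \<Omega> c u f
           \<longrightarrow> (\<forall>\<phi> \<in> L2 \<mu>. \<forall>\<psi> \<in> L2 \<mu>.
                  is_trace \<Omega> \<mu> c u \<phi> \<and> weak_conormal \<Omega> \<mu> c u \<phi>
                  \<and> is_trace \<Omega> \<mu> c u \<psi> \<and> weak_conormal \<Omega> \<mu> c u \<psi>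
                  \<longrightarrow> (AE x in \<mu>. \<phi> x = \<psi> x)))"
    (is "(?A \<longleftrightarrow> ?T) \<and> ?U")
proof -
  interpret neumann_boundary \<Omega> c \<theta> \<mu>
    by (intro neumann_boundary.intro neumann_closable_form assms)
  have "?T" if A: ?A
  proof -
    obtain \<phi> where \<phi>: "\<phi> \<in> L2 \<mu>" "is_trace \<Omega> \<mu> c u \<phi>"
      and eq: "\<And>v. v \<in> bdry_dom \<Omega> \<mu> \<Longrightarrow> neumann_closure \<Omega> c u v + L2_inner \<mu> \<phi> v = L2_inner (lebesgue_on \<Omega>) f v"
      using assoc_op_imp_trace[OF assms(9) A] by blast
    have w: "weakly_eq \<Omega> c u f" by (rule weakly_eqI[OF \<phi>(2) assms(10) eq])
    moreover have "weak_conormal \<Omega> \<mu> c u \<phi>" unfolding conormal_iff[OF w] using eq by blast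
    moreover have "u \<in> H1_trace \<Omega> \<mu> c" using \<phi> by (auto simp: H1_trace_def is_trace_def)
    ultimately show ?thesis using \<phi> by blast
  qed
  moreover have ?A if ?T
    using that conormal_iff[of u f] by (blast intro: trace_imp_assoc_op[OF assms(9,10)])
  moreover have ?U using trace_unique by blast
  ultimately show ?thesis by blast
qed

end
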